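(* Let $10/3<p<6$, and for $\lambda<\Lambda_0$ let $u_\lambda$ be a positive ground state of $-\Delta u+(x_1^2+x_2^2)u=\lambda u+|u|^{p-2}u$ in $\mathbb R^3$. Then $$\sup_{\lambda<\Lambda_0}\|u_\lambda\|_{L^2(\mathbb R^3)}\le C$$ for some $C>0$ independent of $\lambda$. In particular, there are no ground states with large $L^2$-norm.
   Context: $H=\{u\in H^1(\mathbb R^3):\int_{\mathbb R^3}(x_1^2+x_2^2)u^2dx<\infty\}$ (real-valued). $\Lambda_0=\inf\sigma(-\Delta+x_1^2+x_2^2)$. For $\lambda<\Lambda_0$ let $J_\lambda(u)=\frac12\int_{\mathbb R^3}(|\nabla u|^2+(x_1^2+x_2^2-\lambda)u^2)dx-\frac1p\int_{\mathbb R^3}|u|^pdx$ and $\mathcal N_\lambda=\{u\in H\setminus\{0\}:\int_{\mathbb R^3}(|\nabla u|^2+(x_1^2+x_2^2-\lambda)u^2)dx=\int_{\mathbb R^3}|u|^pdx\}$. A positive ground state $u_\lambda$ is a positive $u_\lambda\in\mathcal N_\lambda$ with $J_\lambda(u_\lambda)=\inf_{\mathcal N_\lambda}J_\lambda$; it exists for every $\lambda<\Lambda_0$ and solves the equation. *)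

theory Defs
  imports "HOL-Analysis.Analysis"
begin

definition square_integrable :: "(real^3 \<Rightarrow> 'b::euclidean_space) \<Rightarrow> bool" where
  "square_integrable f \<longleftrightarrow>
     f \<in> borel_measurable lebesgue \<and> integrable lebesgue (\<lambda>x. (norm (f x))\<^sup>2)"

text \<open>The \<open>L\<^sup>2\<close> norm; meaningful for square integrable functions only.\<close>

definition norm_L2 :: "(real^3 \<Rightarrow> 'b::euclidean_space) \<Rightarrow> real" where
  "norm_L2 f = sqrt (\<integral>x. (norm (f x))\<^sup>2 \<partial>lebesgue)"

definition partial :: "3 \<Rightarrow> (real^3 \<Rightarrow> real) \<Rightarrow> real^3 \<Rightarrow> real" where
  "partial i f x = frechet_derivative f (at x) (axis i 1)"

definition laplacian :: "(real^3 \<Rightarrow> real) \<Rightarrow> real^3 \<Rightarrow> real" where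
  "laplacian f x = (\<Sum>i\<in>UNIV. partial i (partial i f) x)"

text \<open>\<open>C\<^sup>\<infinity>\<close> functions: all iterated partial derivatives (including the function itself, for the
  empty list of indices) are everywhere Frechet differentiable, hence continuous.\<close>

definition smooth :: "(real^3 \<Rightarrow> real) \<Rightarrow> bool" where
  "smooth f \<longleftrightarrow> (\<forall>is x. fold partial is f differentiable (at x))"

definition test_function :: "(real^3 \<Rightarrow> real) \<Rightarrow> bool" where
  "test_function \<phi> \<longleftrightarrow> smooth \<phi> \<and> (\<exists>K. compact K \<and> (\<forall>x. x \<notin> K \<longrightarrow> \<phi> x = 0))"

definition has_weak_gradient :: "(real^3 \<Rightarrow> real) \<Rightarrow> (real^3 \<Rightarrow> real^3) \<Rightarrow> bool" where
  "has_weak_gradient u G \<longleftrightarrow>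
     (\<forall>\<phi> i. test_function \<phi> \<longrightarrow>
        (\<integral>x. u x * partial i \<phi> x \<partial>lebesgue) = - (\<integral>x. G x $ i * \<phi> x \<partial>lebesgue))"

definition H1 :: "(real^3 \<Rightarrow> real) set" where
  "H1 = {u. square_integrable u \<and> (\<exists>G. square_integrable G \<and> has_weak_gradient u G)}"

text \<open>For \<open>u \<in> H1\<close> this is determined up to a null set.\<close>

definition weak_gradient :: "(real^3 \<Rightarrow> real) \<Rightarrow> real^3 \<Rightarrow> real^3" where
  "weak_gradient u = (SOME G. square_integrable G \<and> has_weak_gradient u G)"

definition potential :: "real^3 \<Rightarrow> real" where
  "potential x = (x $ 1)\<^sup>2 + (x $ 2)\<^sup>2"

text \<open>The self-adjoint realization of \<open>-\<Delta> + x\<^sub>1\<^sup>2 + x\<^sub>2\<^sup>2\<close> in the complex space \<open>L\<^sup>2\<close>, as a relation: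
  \<open>u\<close> belongs to the domain and is mapped to \<open>f\<close>. Here \<open>u\<close> and \<open>f\<close> are square integrable and
  \<open>-\<Delta>u + (x\<^sub>1\<^sup>2 + x\<^sub>2\<^sup>2) u = f\<close> holds in the sense of distributions (real test functions suffice by
  linearity). This is the adjoint of the operator on smooth compactly supported functions; as the
  potential is nonnegative and locally square integrable, the latter is essentially self-adjoint,
  and so this is its unique self-adjoint extension.\<close>

definition schroedinger :: "(real^3 \<Rightarrow> complex) \<Rightarrow> (real^3 \<Rightarrow> complex) \<Rightarrow> bool" where
  "schroedinger u f \<longleftrightarrow> square_integrable u \<and> square_integrable f \<and>
     (\<forall>\<phi>. test_function \<phi> \<longrightarrow>
        (\<integral>x. (- laplacian \<phi> x + potential x * \<phi> x) *\<^sub>R u x \<partial>lebesgue)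
        = (\<integral>x. \<phi> x *\<^sub>R f x \<partial>lebesgue))"

text \<open>The points \<open>z\<close> such that, writing \<open>A\<close> for the operator above, \<open>A - z\<close> is a bijection from its
  domain onto \<open>L\<^sup>2\<close> with bounded inverse; the equation \<open>(A - z) u = g\<close> is stated as \<open>A u = g + z u\<close>.
  Injectivity (up to null sets) is the case \<open>g = 0\<close> of the bound.\<close>

definition resolvent_set :: "complex set" where
  "resolvent_set = {z. \<exists>C. \<forall>g. square_integrable g \<longrightarrow>
     (\<exists>u. schroedinger u (\<lambda>x. g x + z * u x)) \<and>
     (\<forall>u. schroedinger u (\<lambda>x. g x + z * u x) \<longrightarrow> norm_L2 u \<le> C * norm_L2 g)}"

definition spectrum :: "complex set" where
  "spectrum = - resolvent_set"

text \<open>The spectrum is real. The infimum is taken in the extended reals, so that no boundedness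
  or nonemptiness is presupposed.\<close>

definition \<Lambda>\<^sub>0 :: ereal where
  "\<Lambda>\<^sub>0 = (INF t\<in>{t::real. complex_of_real t \<in> spectrum}. ereal t)"

definition H :: "(real^3 \<Rightarrow> real) set" where
  "H = {u \<in> H1. integrable lebesgue (\<lambda>x. potential x * (u x)\<^sup>2)}"

definition quad_form :: "real \<Rightarrow> (real^3 \<Rightarrow> real) \<Rightarrow> real" where
  "quad_form \<mu> u =
     (\<integral>x. (norm (weak_gradient u x))\<^sup>2 + (potential x - \<mu>) * (u x)\<^sup>2 \<partial>lebesgue)"

definition J :: "real \<Rightarrow> real \<Rightarrow> (real^3 \<Rightarrow> real) \<Rightarrow> real" where
  "J p \<mu> u = 1 / 2 * quad_form \<mu> u - 1 / p * (\<integral>x. \<bar>u x\<bar> powr p \<partial>lebesgue)"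

text \<open>For \<open>2 \<le> p \<le> 6\<close> the \<open>p\<close>-th powers of members of \<open>H\<close> are integrable by Sobolev embedding.\<close>

definition nehari :: "real \<Rightarrow> real \<Rightarrow> (real^3 \<Rightarrow> real) set" where
  "nehari p \<mu> = {u \<in> H. \<not> (AE x in lebesgue. u x = 0) \<and>
     quad_form \<mu> u = (\<integral>x. \<bar>u x\<bar> powr p \<partial>lebesgue)}"

definition ground_state :: "real \<Rightarrow> real \<Rightarrow> (real^3 \<Rightarrow> real) \<Rightarrow> bool" where
  "ground_state p \<mu> u \<longleftrightarrow> u \<in> nehari p \<mu> \<and> J p \<mu> u = (INF v\<in>nehari p \<mu>. J p \<mu> v)"

definition positive_ground_state :: "real \<Rightarrow> real \<Rightarrow> (real^3 \<Rightarrow> real) \<Rightarrow> bool" where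
  "positive_ground_state p \<mu> u \<longleftrightarrow> ground_state p \<mu> u \<and> (AE x in lebesgue. u x > 0)"

end

(* For mu < 2 the harmonic oscillator bound quad_form mu u >= (2 - mu) |u|_2^2 holds on H, and on the
   Nehari manifold J is a positive multiple of quad_form. So the L2 norm of a ground state is
   controlled by the value of J at any competitor, divided by delta = 2 - mu. Gaussians with
   coefficients (a, a, delta), a = max 1 delta, rescaled to lie on the manifold, give the bound
   |u|_2^2 <= C delta^(2/(p-2)) / (a sqrt delta), which stays bounded for delta -> 0 because p <= 6
   and for delta -> infinity because p >= 10/3. Finally Lambda_0 <= 2, as a Weyl sequence of Gaussians
   shows that 2 lies in the spectrum. *)

theory Submission
  imports Defs "HOL-Probability.Distributions" "HOL-Computational_Algebra.Polynomial"
begin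

subsection \<open>Smooth bump functions\<close>

text \<open>The definitions shape much of the work. \<open>weak_gradient\<close> is picked by
  \<open>SOME\<close>, so even for an explicit Gaussian the quadratic form can be computed only once
  weak gradients are known to be unique almost everywhere. That requires a supply of test functions,
  built here from exp (-1/t). The oscillator inequality has to hold for every member of
  \<open>H\<close>, which is known only through weak derivatives. Instead of approximation by smooth
  functions, translations are used: L2 difference quotients are bounded by the weak derivative, and
  the commutator of x_i with a translation by h takes the place of the commutator of x_i with the
  derivative. Gaussians suit both ends of the argument because coefficient 1 in the directions 1 and
  2 is exactly the minimiser of the two oscillators: the energy 2 cancels, and what remains is of
  order delta. Without this cancellation the competitor bound would not survive the division by
  delta as delta tends to 0.\<close>

lemma partial_eqI:
  assumes "(f has_derivative f') (at x)"
  shows "partial i f x = f' (axis i 1)"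
  using frechet_derivative_at[OF assms] by (simp add: partial_def)

text \<open>Smoothness speaks of all iterated partial derivatives. An invariant class of
  differentiable functions contains all of them at once, so no formula for the iterates has to be
  found.\<close>

lemma smooth_coinduct:
  assumes "f \<in> K"
    and "\<And>g x. g \<in> K \<Longrightarrow> g differentiable (at x)"
    and "\<And>g i. g \<in> K \<Longrightarrow> partial i g \<in> K"
  shows "smooth f"
proof -
  have "fold partial is g \<in> K" if "g \<in> K" for "is" g
    using that by (induction "is" arbitrary: g) (auto intro: assms(3))
  then show ?thesis
    using assms(1,2) by (auto simp: smooth_def)
qed

lemma smooth_partial:
  assumes "smooth f"
  shows "smooth (partial i f)"
proof -
  have "fold partial is (partial i f) differentiable (at x)" for "is" x
    using assms[unfolded smooth_def, rule_format, of "i # is" x] by simp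
  then show ?thesis by (simp add: smooth_def)
qed

lemma smooth_differentiable:
  assumes "smooth f"
  shows "f differentiable (at x)"
  using assms[unfolded smooth_def, rule_format, of "[]" x] by simp

lemma smooth_continuous:
  assumes "smooth f"
  shows "continuous_on S f"
  using smooth_differentiable[OF assms]
  by (meson continuous_at_imp_continuous_on differentiable_imp_continuous_within)

lemma test_function_partial:
  assumes "test_function \<phi>"
  shows "test_function (partial i \<phi>)"
proof -
  from assms obtain K where K: "compact K" "\<And>x. x \<notin> K \<Longrightarrow> \<phi> x = 0" and "smooth \<phi>"
    by (auto simp: test_function_def)
  have "partial i \<phi> x = 0" if "x \<notin> K" for x
  proof -
    have "((\<lambda>x. 0) has_derivative (\<lambda>x. 0)) (at x)" by simp
    then have "(\<phi> has_derivative (\<lambda>x. 0)) (at x)"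
      by (rule has_derivative_transform_within_open[of _ _ _ _ "- K"])
        (use K that in \<open>auto intro: compact_imp_closed\<close>)
    from partial_eqI[OF this] show ?thesis by simp
  qed
  then show ?thesis
    using K smooth_partial[OF \<open>smooth \<phi>\<close>] by (auto simp: test_function_def)
qed

lemma partial_translate:
  assumes "f differentiable (at (x + c))"
  shows "partial i (\<lambda>x. f (x + c)) x = partial i f (x + c)"
    and "(\<lambda>x. f (x + c)) differentiable (at x)"
proof -
  from assms have "(f has_derivative frechet_derivative f (at (x + c))) (at (x + c))"
    by (simp add: frechet_derivative_works)
  moreover have "((\<lambda>x. x + c) has_derivative (\<lambda>h. h)) (at x)"
    by (auto intro!: derivative_eq_intros)
  ultimately have *: "((\<lambda>x. f (x + c)) has_derivative frechet_derivative f (at (x + c))) (at x)"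
    using has_derivative_compose by blast
  show "partial i (\<lambda>x. f (x + c)) x = partial i f (x + c)"
    using partial_eqI[OF *] by (simp add: partial_def)
  show "(\<lambda>x. f (x + c)) differentiable (at x)"
    using * by (auto simp: differentiable_def)
qed

text \<open>Needed to apply the definition of a weak gradient to shifted test functions, which is
  how translations of a weakly differentiable function are handled below.\<close>

lemma test_function_translate:
  assumes "test_function \<phi>"
  shows "test_function (\<lambda>x. \<phi> (x + c))"
proof -
  from assms obtain K where K: "compact K" "\<And>x. x \<notin> K \<Longrightarrow> \<phi> x = 0" and "smooth \<phi>"
    by (auto simp: test_function_def)
  have "smooth (\<lambda>x. \<phi> (x + c))"
  proof (rule smooth_coinduct[where K = "{\<lambda>x. g (x + c) | g. smooth g}"])
    show "(\<lambda>x. \<phi> (x + c)) \<in> {\<lambda>x. g (x + c) | g. smooth g}"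
      using \<open>smooth \<phi>\<close> by blast
    fix h assume "h \<in> {\<lambda>x. g (x + c) | g. smooth g}"
    then obtain g where g: "h = (\<lambda>x. g (x + c))" "smooth g" by blast
    show "h differentiable (at x)" for x
      using g partial_translate(2) smooth_differentiable by blast
    have "partial i h = (\<lambda>x. partial i g (x + c))" for i
      using g partial_translate(1) smooth_differentiable by blast
    then show "partial i h \<in> {\<lambda>x. g (x + c) | g. smooth g}" for i
      using smooth_partial[OF \<open>smooth g\<close>] by blast
  qed
  moreover have "compact ((\<lambda>x. x - c) ` K)"
    using K(1) by (intro compact_continuous_image continuous_intros)
  moreover have "\<phi> (x + c) = 0" if "x \<notin> (\<lambda>x. x - c) ` K" for x
    using that K(2)[of "x + c"] by (force simp: image_iff)
  ultimately show ?thesis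
    unfolding test_function_def by blast
qed

section \<open>Smooth functions built from exp (-1/t)\<close>

definition flat :: "real poly \<Rightarrow> real \<Rightarrow> real" where
  "flat P t = (if t > 0 then poly P (1 / t) * exp (- 1 / t) else 0)"

lemma poly_exp_neg_tendsto_0: "((\<lambda>y. poly P y * exp (- y)) \<longlongrightarrow> (0::real)) at_top"
proof -
  have "((\<lambda>y. \<Sum>i\<le>degree P. coeff P i * (y ^ i / exp y)) \<longlongrightarrow> (\<Sum>i\<le>degree P. coeff P i * 0)) at_top"
    by (intro tendsto_intros tendsto_power_div_exp_0)
  then show ?thesis
    by (simp add: poly_altdef sum_distrib_right exp_minus divide_inverse mult.assoc)
qed

text \<open>For t > 0 the derivative of P(1/t) exp (-1/t) is t^(-2) (P - P')(1/t) exp (-1/t).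
  Carrying an arbitrary polynomial in 1/t thus makes the family closed under differentiation, which
  plain exp (-1/t) is not.\<close>

lemma flat_has_derivative:
  "(flat P has_real_derivative flat (monom 1 2 * (P - pderiv P)) t) (at t)"
proof -
  consider "t > 0" | "t < 0" | "t = 0" by linarith
  then show ?thesis
  proof cases
    case 1
    have "((\<lambda>t. poly P (1 / t) * exp (- 1 / t)) has_real_derivative
        flat (monom 1 2 * (P - pderiv P)) t) (at t)"
      using 1 unfolding flat_def
      by (auto intro!: derivative_eq_intros DERIV_chain2[where f="poly P"] poly_DERIV
          simp: poly_monom power2_eq_square field_simps)
    then show ?thesis
      by (rule has_field_derivative_transform_within_open[OF _ open_greaterThan[of 0]]) (use 1 in \<open>auto simp: flat_def\<close>)
  next
    case 2
    have "((\<lambda>t. 0) has_real_derivative flat (monom 1 2 * (P - pderiv P)) t) (at t)"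
      using 2 by (simp add: flat_def)
    then show ?thesis
      by (rule has_field_derivative_transform_within_open[OF _ open_lessThan[of 0]]) (use 2 in \<open>auto simp: flat_def\<close>)
  next
    case 3
    have "((\<lambda>h. flat P h / h) \<longlongrightarrow> 0) (at_right 0)"
    proof -
      \<comment> \<open>With y = 1/h, dividing by h multiplies the polynomial by y, which is
        \<open>pCons 0 P\<close>; the exponential then beats it as y grows.\<close>
      have "((\<lambda>h. poly (pCons 0 P) (inverse h) * exp (- inverse h)) \<longlongrightarrow> 0) (at_right 0)"
        using filterlim_compose[OF poly_exp_neg_tendsto_0 filterlim_inverse_at_top_right] .
      moreover have "eventually (\<lambda>h. poly (pCons 0 P) (inverse h) * exp (- inverse h) = flat P h / h) (at_right 0)"
        by (auto simp: flat_def divide_inverse eventually_at_right_field intro!: exI[of _ 1])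
      ultimately show ?thesis
        using tendsto_cong by fast
    qed
    moreover have "((\<lambda>h. flat P h / h) \<longlongrightarrow> 0) (at_left 0)"
      by (rule tendsto_eventually) (auto simp: flat_def eventually_at_left_field intro!: exI[of _ "-1"])
    ultimately have "((\<lambda>h. flat P h / h) \<longlongrightarrow> 0) (at 0)"
      by (rule filterlim_split_at[rotated])
    then show ?thesis
      using 3 by (simp add: DERIV_def flat_def)
  qed
qed

text \<open>The algebra generated by constants and by \<open>flat\<close> functions of an affine
  function of one coordinate. It contains the cut-off products used below and is closed under
  partial derivatives, so it can serve as the invariant class in
  \<open>smooth_coinduct\<close>.\<close>

inductive_set bumps :: "(real^3 \<Rightarrow> real) set" where
  flat: "(\<lambda>x. flat P (c * x $ i + d)) \<in> bumps"
| const: "(\<lambda>x. c) \<in> bumps"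
| add: "f \<in> bumps \<Longrightarrow> g \<in> bumps \<Longrightarrow> (\<lambda>x. f x + g x) \<in> bumps"
| mult: "f \<in> bumps \<Longrightarrow> g \<in> bumps \<Longrightarrow> (\<lambda>x. f x * g x) \<in> bumps"

lemma bumps_partial:
  assumes "f \<in> bumps"
  shows "(\<forall>x. f differentiable (at x)) \<and> (\<forall>i. partial i f \<in> bumps)"
  using assms
proof (induction)
  case (flat P c k d)
  let ?Q = "monom 1 2 * (P - pderiv P)"
  have *: "((\<lambda>x. flat P (c * x $ k + d)) has_derivative (\<lambda>h. c * h $ k * flat ?Q (c * x $ k + d))) (at x)"
    for x :: "real^3"
  proof -
    have "((\<lambda>x. c * x $ k + d) has_derivative (\<lambda>h. c * h $ k)) (at x)"
      by (auto intro!: derivative_eq_intros bounded_linear.has_derivative[OF bounded_linear_vec_nth])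
    from has_derivative_compose[OF this flat_has_derivative[unfolded has_field_derivative_def]]
    show ?thesis by (simp add: mult.commute)
  qed
  have "partial i (\<lambda>x. flat P (c * x $ k + d)) = (\<lambda>x. (c * axis i 1 $ k) * flat ?Q (c * x $ k + d))" for i
    using partial_eqI[OF *] by auto
  then show ?case
    using * by (auto simp: differentiable_def intro!: bumps.mult bumps.const bumps.flat)
next
  case (const c)
  have "partial i (\<lambda>x. c) = (\<lambda>x. 0)" for i
    by (rule ext, rule partial_eqI) simp
  then show ?case by (auto intro: bumps.const)
next
  case (add f g)
  have "partial i (\<lambda>x. f x + g x) = (\<lambda>x. partial i f x + partial i g x)" for i
    unfolding partial_def
    by (rule ext, rule partial_eqI[unfolded partial_def])
      (use add in \<open>auto intro!: has_derivative_add simp: frechet_derivative_works[symmetric]\<close>)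
  then show ?case using add by (auto intro: bumps.add)
next
  case (mult f g)
  have "partial i (\<lambda>x. f x * g x) = (\<lambda>x. f x * partial i g x + partial i f x * g x)" for i
    unfolding partial_def
    by (rule ext, rule partial_eqI[unfolded partial_def])
      (use mult in \<open>auto intro!: has_derivative_mult simp: frechet_derivative_works[symmetric]\<close>)
  then show ?case
    using mult by (auto intro!: bumps.add[of "\<lambda>x. f x * partial _ g x"] bumps.mult)
qed

lemma bumps_smooth: "f \<in> bumps \<Longrightarrow> smooth f"
  using smooth_coinduct[of f bumps] bumps_partial by blast

lemma bumps_prod:
  assumes "finite A" "\<And>i. i \<in> A \<Longrightarrow> f i \<in> bumps"
  shows "(\<lambda>x. \<Prod>i\<in>A. f i x) \<in> bumps"
  using assms by (induction A) (auto intro: bumps.const bumps.mult)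

lemma flat_one_bounds: "0 \<le> flat 1 t" "flat 1 t \<le> 1" "t \<le> 0 \<Longrightarrow> flat 1 t = 0"
  by (auto simp: flat_def)

lemma flat_one_tendsto:
  assumes "t > 0"
  shows "(\<lambda>n. flat 1 (real (Suc n) * t)) \<longlonglongrightarrow> 1"
proof -
  have "(\<lambda>n. exp (- (inverse (real (Suc n)) * inverse t))) \<longlonglongrightarrow> exp (- (0 * inverse t))"
    by (intro tendsto_intros LIMSEQ_inverse_real_of_nat)
  moreover have "flat 1 (real (Suc n) * t) = exp (- (inverse (real (Suc n)) * inverse t))" for n
    using assms by (simp add: flat_def divide_inverse)
  ultimately show ?thesis by (simp del: of_nat_Suc)
qed

text \<open>Each face of the box contributes a factor exp (-1/(m d)), where d is the signed distance
  to the face and m = n + 1, replaced by 0 when d is not positive. The factors vanish outside the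
  box, are at most 1, and tend to 1 inside as m grows.\<close>

lemma ex_test_function_sequence:
  fixes a b :: "real^3"
  obtains \<phi> where "\<And>n. test_function (\<phi> n)" "\<And>n x. \<bar>\<phi> n x\<bar> \<le> indicator (box a b) x"
    "\<And>x. (\<lambda>n. \<phi> n x) \<longlonglongrightarrow> indicator (box a b) x"
proof
  define \<phi> where "\<phi> n x = (\<Prod>i\<in>UNIV. flat 1 (real (Suc n) * (x $ i - a $ i)) * flat 1 (real (Suc n) * (b $ i - x $ i)))"
    for n :: nat and x :: "real^3"
  have out: "\<phi> n x = 0" if "x \<notin> box a b" for n x
  proof -
    from that have "\<exists>i. x $ i - a $ i \<le> 0 \<or> b $ i - x $ i \<le> 0"
      by (auto simp: mem_box_cart not_less)
    then obtain i where "x $ i - a $ i \<le> 0 \<or> b $ i - x $ i \<le> 0" ..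
    then have "flat 1 (real (Suc n) * (x $ i - a $ i)) * flat 1 (real (Suc n) * (b $ i - x $ i)) = 0"
      by (auto intro!: flat_one_bounds(3) mult_nonneg_nonpos)
    then show ?thesis unfolding \<phi>_def by (meson UNIV_I finite prod_zero_iff)
  qed
  \<comment> \<open>The arguments are brought into the affine form c * x $ i + d that the generators
    of \<open>bumps\<close> require.\<close>
  have "\<phi> n = (\<lambda>x. \<Prod>i\<in>UNIV. flat 1 (real (Suc n) * x $ i + real (Suc n) * (- a $ i)) * flat 1 (- real (Suc n) * x $ i + real (Suc n) * b $ i))" for n
    by (simp add: fun_eq_iff \<phi>_def right_diff_distrib del: of_nat_Suc)
  also have "\<dots> n \<in> bumps" for n
    by (intro bumps_prod bumps.mult bumps.flat) auto
  finally have "smooth (\<phi> n)" for n by (rule bumps_smooth)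
  moreover have "\<forall>x. x \<notin> cbox a b \<longrightarrow> \<phi> n x = 0" for n
    using out box_subset_cbox by blast
  ultimately show "test_function (\<phi> n)" for n
    unfolding test_function_def by (intro conjI exI[of _ "cbox a b"] compact_cbox) auto
  show "\<bar>\<phi> n x\<bar> \<le> indicator (box a b) x" for n x
  proof (cases "x \<in> box a b")
    case True
    have "0 \<le> \<phi> n x" "\<phi> n x \<le> 1"
      unfolding \<phi>_def
      by (intro prod_nonneg prod_le_1 conjI mult_le_one mult_nonneg_nonneg flat_one_bounds)+
    then show ?thesis using True by simp
  qed (simp add: out)
  show "(\<lambda>n. \<phi> n x) \<longlonglongrightarrow> indicator (box a b) x" for x
  proof (cases "x \<in> box a b")
    case True
    then have "(\<lambda>n. \<phi> n x) \<longlonglongrightarrow> (\<Prod>i\<in>(UNIV::3 set). 1 * 1)"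
      unfolding \<phi>_def by (intro tendsto_prod tendsto_mult flat_one_tendsto) (auto simp: mem_box_cart)
    then show ?thesis using True by simp
  qed (simp add: out)
qed

subsection \<open>Integration by parts and the fundamental lemma\<close>

lemma
  fixes f :: "'a::euclidean_space \<Rightarrow> 'b::{banach, second_countable_topology}"
  assumes [measurable]: "f \<in> borel_measurable borel"
  shows lborel_integral_translate: "(\<integral>x. f (x + c) \<partial>lborel) = (\<integral>x. f x \<partial>lborel)"
    and lborel_integrable_translate: "integrable lborel (\<lambda>x. f (x + c)) \<longleftrightarrow> integrable lborel f"
proof -
  show "(\<integral>x. f (x + c) \<partial>lborel) = (\<integral>x. f x \<partial>lborel)"
    by (subst (2) lborel_distr_plus[of c, symmetric]) (simp add: integral_distr add.commute)
  show "integrable lborel (\<lambda>x. f (x + c)) \<longleftrightarrow> integrable lborel f"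
    by (subst (2) lborel_distr_plus[of c, symmetric]) (simp add: integrable_distr_eq add.commute)
qed

lemma integrable_mult_square:
  fixes f g :: "'a \<Rightarrow> real"
  assumes [measurable]: "f \<in> borel_measurable M" "g \<in> borel_measurable M"
    and "integrable M (\<lambda>x. (f x)\<^sup>2)" "integrable M (\<lambda>x. (g x)\<^sup>2)"
  shows "integrable M (\<lambda>x. f x * g x)"
proof (rule Bochner_Integration.integrable_bound)
  show "integrable M (\<lambda>x. (f x)\<^sup>2 + (g x)\<^sup>2)" using assms by simp
  have "\<bar>s * t\<bar> \<le> s\<^sup>2 + t\<^sup>2" for s t :: real
  proof -
    have "2 * (\<bar>s\<bar> * \<bar>t\<bar>) \<le> s\<^sup>2 + t\<^sup>2" "0 \<le> \<bar>s\<bar> * \<bar>t\<bar>"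
      using sum_squares_bound[of "\<bar>s\<bar>" "\<bar>t\<bar>"] by (simp_all add: mult.assoc)
    then show ?thesis unfolding abs_mult by linarith
  qed
  then show "AE x in M. norm (f x * g x) \<le> norm ((f x)\<^sup>2 + (g x)\<^sup>2)" by simp
qed measurable

text \<open>Integrated form of 2ab <= a^2 + b^2. Its sharp constant is what later yields the sharp
  constant 1 in the oscillator inequality.\<close>

lemma integral_mult_square_le:
  fixes f g :: "'a \<Rightarrow> real"
  assumes [measurable]: "f \<in> borel_measurable M" "g \<in> borel_measurable M"
    and "integrable M (\<lambda>x. (f x)\<^sup>2)" "integrable M (\<lambda>x. (g x)\<^sup>2)"
  shows "2 * \<bar>\<integral>x. f x * g x \<partial>M\<bar> \<le> (\<integral>x. (f x)\<^sup>2 \<partial>M) + (\<integral>x. (g x)\<^sup>2 \<partial>M)"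
proof -
  note int = integrable_mult_square[OF assms]
  have "2 * \<bar>\<integral>x. f x * g x \<partial>M\<bar> \<le> (\<integral>x. 2 * \<bar>f x * g x\<bar> \<partial>M)"
    using integral_abs_bound[of M "\<lambda>x. f x * g x"] int by simp
  also have "\<dots> \<le> (\<integral>x. (f x)\<^sup>2 + (g x)\<^sup>2 \<partial>M)"
  proof (rule integral_mono)
    show "2 * \<bar>f x * g x\<bar> \<le> (f x)\<^sup>2 + (g x)\<^sup>2" for x
      using sum_squares_bound[of "\<bar>f x\<bar>" "\<bar>g x\<bar>"] unfolding abs_mult by simp
  qed (use int assms in auto)
  finally show ?thesis using assms by simp
qed

lemma continuous_compact_support_bound:
  fixes f :: "'a::euclidean_space \<Rightarrow> real"
  assumes "continuous_on UNIV f" "\<And>x. x \<notin> cball 0 R \<Longrightarrow> f x = 0"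
  obtains B where "B \<ge> 0" "\<And>x. \<bar>f x\<bar> \<le> B * indicator (cball 0 R) x"
proof -
  have "continuous_on (cball 0 R) f"
    using assms(1) continuous_on_subset by blast
  from continuous_on_compact_bound[OF compact_cball this]
  obtain B where "B \<ge> 0" "\<And>x. x \<in> cball 0 R \<Longrightarrow> norm (f x) \<le> B" by blast
  then show thesis
    using assms(2) by (intro that[of B]) (auto split: split_indicator)
qed

lemma integrable_compact_support:
  fixes f :: "'a::euclidean_space \<Rightarrow> real"
  assumes "continuous_on UNIV f" "\<And>x. x \<notin> cball 0 R \<Longrightarrow> f x = 0"
  shows "integrable lborel f"
proof -
  have "integrable lborel (\<lambda>x. indicator (cball 0 R) x *\<^sub>R f x)"
    by (intro borel_integrable_compact compact_cball continuous_on_subset[OF assms(1)] subset_UNIV)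
  also have "(\<lambda>x. indicator (cball 0 R) x *\<^sub>R f x) = f"
    using assms(2) by (auto split: split_indicator)
  finally show ?thesis .
qed

lemma test_function_support:
  assumes "test_function \<phi>"
  obtains R where "\<And>x. x \<notin> cball 0 R \<Longrightarrow> \<phi> x = 0"
proof -
  from assms obtain K where K: "compact K" "\<And>x. x \<notin> K \<Longrightarrow> \<phi> x = 0"
    by (auto simp: test_function_def)
  obtain R where "\<And>x. x \<in> K \<Longrightarrow> norm x \<le> R"
    using compact_imp_bounded[OF K(1)] by (auto simp: bounded_iff)
  then show thesis using that[of R] K(2) by auto
qed

lemma test_function_differentiable: "test_function \<phi> \<Longrightarrow> \<phi> differentiable (at x)"
  using smooth_differentiable by (auto simp: test_function_def)

lemma test_function_continuous: "test_function \<phi> \<Longrightarrow> continuous_on S \<phi>"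
  using smooth_continuous by (auto simp: test_function_def)

lemma test_function_measurable: "test_function \<phi> \<Longrightarrow> \<phi> \<in> borel_measurable borel"
  using test_function_continuous borel_measurable_continuous_onI by blast

lemma test_function_integrable_square:
  assumes "test_function \<phi>"
  shows "integrable lborel (\<lambda>x. (\<phi> x)\<^sup>2)"
proof -
  obtain R where "\<And>x. x \<notin> cball 0 R \<Longrightarrow> \<phi> x = 0"
    using test_function_support[OF assms] by blast
  then show ?thesis
    using test_function_continuous[OF assms]
    by (intro integrable_compact_support[of _ R] continuous_intros) auto
qed

text \<open>Reduces to functions of one real variable, so that the mean value theorem and the
  fundamental theorem of calculus become available.\<close>

lemma line_derivative:
  assumes "f differentiable (at (x + t *\<^sub>R axis i 1))"
  shows "((\<lambda>t. f (x + t *\<^sub>R axis i 1)) has_real_derivative partial i f (x + t *\<^sub>R axis i 1)) (at t)"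
proof -
  let ?y = "x + t *\<^sub>R axis i 1" and ?D = "frechet_derivative f (at (x + t *\<^sub>R axis i 1))"
  have D: "(f has_derivative ?D) (at ?y)"
    using assms by (simp add: frechet_derivative_works)
  have "((\<lambda>t. x + t *\<^sub>R axis i 1) has_derivative (\<lambda>h. h *\<^sub>R axis i 1)) (at t)"
    by (auto intro!: derivative_eq_intros)
  from has_derivative_compose[OF this D]
  have "((\<lambda>t. f (x + t *\<^sub>R axis i 1)) has_derivative (\<lambda>h. ?D (h *\<^sub>R axis i 1))) (at t)" .
  moreover have "(\<lambda>h. ?D (h *\<^sub>R axis i 1)) = (\<lambda>h. partial i f ?y * h)"
    using linear_scale[OF has_derivative_linear[OF D]] by (auto simp: partial_def)
  ultimately show ?thesis by (simp add: has_field_derivative_def)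
qed

text \<open>By translation invariance the difference quotients have integral \<open>0\<close>.\<close>

lemma integral_partial_eq_0:
  assumes diff: "\<And>x. f differentiable (at x)"
    and cont: "continuous_on UNIV (partial i f)"
    and supp: "\<And>x. x \<notin> cball 0 R \<Longrightarrow> f x = 0"
  shows "(\<integral>x. partial i f x \<partial>lborel) = 0"
proof -
  let ?e = "axis i 1 :: real^3"
  define h where "h n = inverse (real (Suc n))" for n
  have h: "h n > 0" "h n \<le> 1" for n
    by (auto simp: h_def inverse_le_1_iff)
  have h0: "h \<longlonglongrightarrow> 0"
    unfolding h_def by (rule LIMSEQ_inverse_real_of_nat)
  define s where "s n x = (f (x + h n *\<^sub>R ?e) - f x) / h n" for n x
  have fc: "continuous_on UNIV f"
    by (simp add: continuous_at_imp_continuous_on diff differentiable_imp_continuous_within)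
  then have [measurable]: "f \<in> borel_measurable borel"
    by (rule borel_measurable_continuous_onI)
  have [measurable]: "partial i f \<in> borel_measurable borel"
    using cont by (rule borel_measurable_continuous_onI)
  have int: "integrable lborel f"
    using fc supp by (rule integrable_compact_support)
  have zero: "partial i f x = 0" if "x \<notin> cball 0 R" for x
  proof -
    have "((\<lambda>x. 0) has_derivative (\<lambda>x. 0)) (at x)" by simp
    then have "(f has_derivative (\<lambda>x. 0)) (at x)"
      by (rule has_derivative_transform_within_open[of _ _ _ _ "- cball 0 R"])
        (use that supp in auto)
    from partial_eqI[OF this] show ?thesis by simp
  qed
  obtain B where B: "B \<ge> 0" "\<And>x. \<bar>partial i f x\<bar> \<le> B * indicator (cball 0 R) x"
    using continuous_compact_support_bound[OF cont zero] by blast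
  have B': "\<bar>partial i f x\<bar> \<le> B" for x
    using B(2)[of x] \<open>B \<ge> 0\<close> by (auto split: split_indicator_asm)
  \<comment> \<open>Domination of the difference quotients: the mean value theorem bounds them by
    \<open>B\<close>, and since the step is at most 1 they vanish outside the ball of radius
    \<open>R + 1\<close>.\<close>
  have bound: "\<bar>s n x\<bar> \<le> B * indicator (cball 0 (R + 1)) x" for n x
  proof (cases "x \<in> cball 0 (R + 1)")
    case True
    obtain z where "f (x + h n *\<^sub>R ?e) - f (x + 0 *\<^sub>R ?e) = (h n - 0) * partial i f (x + z *\<^sub>R ?e)"
      using MVT2[of 0 "h n" "\<lambda>t. f (x + t *\<^sub>R ?e)" "\<lambda>t. partial i f (x + t *\<^sub>R ?e)"]
        line_derivative diff h(1) by blast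
    then have "s n x = partial i f (x + z *\<^sub>R ?e)"
      using h(1)[of n] by (simp add: s_def)
    then show ?thesis using True B' by simp
  next
    case False
    have "norm x \<le> norm (x + h n *\<^sub>R ?e) + norm (h n *\<^sub>R ?e)"
      by (metis add_diff_cancel_right' norm_triangle_ineq4)
    then have "norm x \<le> norm (x + h n *\<^sub>R ?e) + 1"
      using h[of n] by simp
    then have "f (x + h n *\<^sub>R ?e) = 0" "f x = 0"
      using False by (auto intro!: supp)
    then show ?thesis using B(1) by (simp add: s_def)
  qed
  have "(\<lambda>n. \<integral>x. s n x \<partial>lborel) \<longlonglongrightarrow> (\<integral>x. partial i f x \<partial>lborel)"
  proof (rule integral_dominated_convergence)
    show "integrable lborel (\<lambda>x. B * indicator (cball 0 (R + 1)) x)"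
      by (intro integrable_mult_right integrable_real_indicator emeasure_lborel_cball_finite) simp
    show "AE x in lborel. (\<lambda>n. s n x) \<longlonglongrightarrow> partial i f x"
    proof (rule AE_I2)
      fix x
      have "((\<lambda>t. (f (x + t *\<^sub>R ?e) - f x) / t) \<longlongrightarrow> partial i f x) (at 0)"
        using line_derivative[OF diff, of x i 0] by (simp add: DERIV_def)
      moreover have "filterlim h (at 0) sequentially"
        using h0 h(1) by (auto simp: filterlim_at less_imp_neq[symmetric] eventually_sequentially)
      ultimately show "(\<lambda>n. s n x) \<longlonglongrightarrow> partial i f x"
        unfolding s_def by (rule filterlim_compose)
    qed
    show "AE x in lborel. norm (s n x) \<le> B * indicator (cball 0 (R + 1)) x" for n
      using bound by simp
  qed (simp_all add: s_def)
  moreover have "(\<integral>x. s n x \<partial>lborel) = 0" for n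
    using int by (simp add: s_def lborel_integral_translate lborel_integrable_translate)
  ultimately show ?thesis by (simp add: LIMSEQ_const_iff)
qed

lemma partial_mult:
  assumes "f differentiable (at x)" "g differentiable (at x)"
  shows "partial i (\<lambda>x. f x * g x) x = f x * partial i g x + partial i f x * g x"
  unfolding partial_def
  by (rule partial_eqI[unfolded partial_def])
    (use assms in \<open>auto intro!: has_derivative_mult simp: frechet_derivative_works[symmetric]\<close>)

text \<open>The product with a test function is compactly supported, so its partial derivative
  integrates to 0. Only the factor \<open>\<phi>\<close> has compact support; Gaussians are the
  intended other factor.\<close>

lemma integral_by_parts_lebesgue:
  assumes diff: "\<And>x. f differentiable (at x)"
    and cont: "continuous_on UNIV (partial i f)"
    and test: "test_function \<phi>"
  shows "(\<integral>x. f x * partial i \<phi> x \<partial>lebesgue) = - (\<integral>x. partial i f x * \<phi> x \<partial>lebesgue)"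
proof -
  note test' = test_function_partial[OF test, of i]
  obtain R where R: "\<And>x. x \<notin> cball 0 R \<Longrightarrow> \<phi> x = 0"
    using test_function_support[OF test] by blast
  obtain R' where R': "\<And>x. x \<notin> cball 0 R' \<Longrightarrow> partial i \<phi> x = 0"
    using test_function_support[OF test'] by blast
  have fc: "continuous_on UNIV f"
    by (simp add: continuous_at_imp_continuous_on diff differentiable_imp_continuous_within)
  note c = fc cont test_function_continuous[OF test] test_function_continuous[OF test']
  have eq: "partial i (\<lambda>x. f x * \<phi> x) = (\<lambda>x. f x * partial i \<phi> x + partial i f x * \<phi> x)"
    using partial_mult diff test_function_differentiable[OF test] by blast
  have "integrable lborel (\<lambda>x. f x * partial i \<phi> x)"
    using R' by (intro integrable_compact_support[of _ R'] continuous_intros c) auto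
  moreover have "integrable lborel (\<lambda>x. partial i f x * \<phi> x)"
    using R by (intro integrable_compact_support[of _ R] continuous_intros c) auto
  moreover have "(\<integral>x. partial i (\<lambda>x. f x * \<phi> x) x \<partial>lborel) = 0"
  proof (rule integral_partial_eq_0)
    show "continuous_on UNIV (partial i (\<lambda>x. f x * \<phi> x))"
      unfolding eq by (intro continuous_intros c)
  qed (use R diff test_function_differentiable[OF test] in auto)
  ultimately have *: "(\<integral>x. f x * partial i \<phi> x \<partial>lborel) = - (\<integral>x. partial i f x * \<phi> x \<partial>lborel)"
    by (simp add: eq)
  note [measurable] = c[THEN borel_measurable_continuous_onI]
  show "(\<integral>x. f x * partial i \<phi> x \<partial>lebesgue) = - (\<integral>x. partial i f x * \<phi> x \<partial>lebesgue)"
    using * by (simp add: integral_completion)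
qed

text \<open>Boxes are stable under intersection and generate the Borel sets, so a Dynkin system
  argument extends vanishing integrals from boxes to all Borel sets; a density with that property is
  0 almost everywhere.\<close>

lemma AE_eq_0_if_box_integrals_eq_0:
  fixes g :: "'a::euclidean_space \<Rightarrow> real"
  assumes int: "\<And>a b. set_integrable lborel (box a b) g"
    and zero: "\<And>a b. set_lebesgue_integral lborel (box a b) g = 0"
  shows "AE x in lborel. g x = 0"
proof -
  have "AE x in lborel. x \<in> box a b \<longrightarrow> g x = 0" for a b :: 'a
  proof -
    \<comment> \<open>Restriction to one box makes the function integrable, as \<open>g\<close> is
      only locally so. The intersection of two boxes is a box, so the hypothesis still applies to
      \<open>f\<close>.\<close>
    define f where "f x = indicator (box a b) x *\<^sub>R g x" for x
    have f: "integrable lborel f"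
      using int unfolding f_def set_integrable_def .
    have sub: "set_integrable lborel A f" if "A \<in> sets lborel" for A
      using integrable_mult_indicator[OF that f] unfolding set_integrable_def .
    have all: "(\<integral>x. f x \<partial>lborel) = 0"
      using zero[of a b] unfolding f_def set_lebesgue_integral_def .
    have "set_lebesgue_integral lborel A f = 0" if "A \<in> sets lborel" for A
    proof -
      let ?G = "range (\<lambda>(a, b). box a b :: 'a set)"
      have "Int_stable ?G"
        by (auto simp: Int_stable_def box_Int_box)
      moreover have "?G \<subseteq> Pow UNIV" by simp
      moreover have "A \<in> sigma_sets UNIV ?G"
        using that by (simp add: borel_eq_box)
      ultimately show ?thesis
      proof (induction rule: sigma_sets_induct_disjoint)
        case (basic A)
        then obtain c d where "A = box c d" by auto
        then obtain l u where "A \<inter> box a b = box l u"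
          using box_Int_box by blast
        then have "indicator A x *\<^sub>R f x = indicator (box l u) x *\<^sub>R g x" for x
          unfolding f_def by (simp add: indicator_inter_arith[symmetric] mult.assoc[symmetric])
        then show ?case
          using zero[of l u] by (simp add: set_lebesgue_integral_def)
      next
        case empty
        then show ?case by (simp add: set_lebesgue_integral_def)
      next
        case (compl A)
        then have "A \<in> sets lborel" by (simp add: borel_eq_box)
        have "set_lebesgue_integral lborel (UNIV - A) f = (\<integral>x. f x - indicator A x *\<^sub>R f x \<partial>lborel)"
          unfolding set_lebesgue_integral_def by (intro Bochner_Integration.integral_cong) (auto split: split_indicator)
        also have "\<dots> = 0"
          using f sub[OF \<open>A \<in> sets lborel\<close>] all compl
          by (simp add: set_integrable_def set_lebesgue_integral_def)
        finally show ?case .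
      next
        case (union A)
        then have "range A \<subseteq> sets lborel" by (simp add: borel_eq_box)
        then have "set_lebesgue_integral lborel (\<Union>i. A i) f = (\<Sum>i. set_lebesgue_integral lborel (A i) f)"
          using union by (intro lebesgue_integral_countable_add sub)
            (auto simp: disjoint_family_on_def intro!: sets.countable_UN)
        then show ?case using union by simp
      qed
    qed
    then have "AE x in lborel. f x = 0"
      using f sigma_finite_measure.density_zero[OF sigma_finite_lborel] by blast
    then show ?thesis
      by eventually_elim (auto simp: f_def)
  qed
  then have "AE x in lborel. \<forall>n. x \<in> box (- (real n *\<^sub>R One)) (real n *\<^sub>R One) \<longrightarrow> g x = 0"
    by (subst AE_all_countable) blast
  then show ?thesis
  proof eventually_elim
    case (elim x)
    have "\<exists>n::nat. x \<in> box (- (real n *\<^sub>R One)) (real n *\<^sub>R One)"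
      using UN_box_eq_UNIV[where 'a='a] by blast
    then show ?case using elim by blast
  qed
qed

text \<open>Test functions converge to the indicator of any box and are dominated by it, so
  dominated convergence turns the hypothesis on test functions into one on box integrals.\<close>

lemma fundamental_lemma:
  assumes int: "\<And>a b. set_integrable lborel (box a b) g"
    and zero: "\<And>\<phi>. test_function \<phi> \<Longrightarrow> (\<integral>x. g x * \<phi> x \<partial>lborel) = 0"
    and [measurable]: "g \<in> borel_measurable borel"
  shows "AE x in lborel. g x = 0"
proof (rule AE_eq_0_if_box_integrals_eq_0[OF int])
  fix a b :: "real^3"
  obtain \<phi> where \<phi>: "\<And>n. test_function (\<phi> n)" "\<And>n x. \<bar>\<phi> n x\<bar> \<le> indicator (box a b) x"
    "\<And>x. (\<lambda>n. \<phi> n x) \<longlonglongrightarrow> indicator (box a b) x"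
    using ex_test_function_sequence[of a b] by blast
  note [measurable] = test_function_measurable[OF \<phi>(1)]
  have "(\<lambda>n. \<integral>x. g x * \<phi> n x \<partial>lborel) \<longlonglongrightarrow> (\<integral>x. g x * indicator (box a b) x \<partial>lborel)"
  proof (rule integral_dominated_convergence)
    show "integrable lborel (\<lambda>x. \<bar>indicator (box a b) x *\<^sub>R g x\<bar>)"
      using int[of a b] by (simp add: set_integrable_def)
    show "AE x in lborel. norm (g x * \<phi> n x) \<le> \<bar>indicator (box a b) x *\<^sub>R g x\<bar>" for n
    proof (rule AE_I2)
      show "norm (g x * \<phi> n x) \<le> \<bar>indicator (box a b) x *\<^sub>R g x\<bar>" for x
        using mult_left_mono[OF \<phi>(2)[of n x] abs_ge_zero[of "g x"]]
        by (simp add: abs_mult mult.commute[of "\<bar>g x\<bar>"])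
    qed
    show "AE x in lborel. (\<lambda>n. g x * \<phi> n x) \<longlonglongrightarrow> g x * indicator (box a b) x"
      by (intro AE_I2 tendsto_mult_left \<phi>(3))
  qed measurable
  then show "set_lebesgue_integral lborel (box a b) g = 0"
    using zero[OF \<phi>(1)] by (simp add: set_lebesgue_integral_def mult.commute LIMSEQ_const_iff)
qed

subsection \<open>The harmonic oscillator inequality\<close>

lemma borel_measurable_lebesgueI: "f \<in> borel_measurable borel \<Longrightarrow> f \<in> borel_measurable lebesgue"
  by (simp add: measurable_completion)

lemma indicator_square: "(indicator A x)\<^sup>2 = (indicator A x :: real)"
  by (simp split: split_indicator)

lemma integrable_indicator_Icc: "integrable lborel (indicator {a..b :: real} :: real \<Rightarrow> real)"
  by (intro integrable_real_indicator) (auto simp: emeasure_lborel_Icc_eq)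

lemma Cauchy_Schwarz_integral:
  fixes f g :: "'a \<Rightarrow> real"
  assumes [measurable]: "f \<in> borel_measurable M" "g \<in> borel_measurable M"
    and int: "integrable M (\<lambda>x. (f x)\<^sup>2)" "integrable M (\<lambda>x. (g x)\<^sup>2)"
  shows "(\<integral>x. f x * g x \<partial>M)\<^sup>2 \<le> (\<integral>x. (f x)\<^sup>2 \<partial>M) * (\<integral>x. (g x)\<^sup>2 \<partial>M)"
proof -
  define A B C where "A = (\<integral>x. (f x)\<^sup>2 \<partial>M)" and "B = (\<integral>x. f x * g x \<partial>M)" and "C = (\<integral>x. (g x)\<^sup>2 \<partial>M)"
  have "A \<ge> 0" "C \<ge> 0" by (auto simp: A_def C_def)
  have *: "2 * (t * \<bar>B\<bar>) \<le> A + t\<^sup>2 * C" for t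
  proof -
    have "2 * \<bar>\<integral>x. f x * (t * g x) \<partial>M\<bar> \<le> (\<integral>x. (f x)\<^sup>2 \<partial>M) + (\<integral>x. (t * g x)\<^sup>2 \<partial>M)"
      by (rule integral_mult_square_le) (use int in \<open>auto simp: power_mult_distrib\<close>)
    also have "(\<integral>x. f x * (t * g x) \<partial>M) = t * B"
      by (simp add: B_def mult.left_commute)
    finally have "2 * (\<bar>t\<bar> * \<bar>B\<bar>) \<le> A + t\<^sup>2 * C"
      by (simp add: A_def C_def power_mult_distrib abs_mult)
    moreover have "t * \<bar>B\<bar> \<le> \<bar>t\<bar> * \<bar>B\<bar>"
      by (intro mult_right_mono) auto
    ultimately show ?thesis by linarith
  qed
  have "B\<^sup>2 \<le> A * C"
  proof (cases "C = 0")
    case True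
    have "B = 0"
    proof (rule ccontr)
      assume "B \<noteq> 0"
      then show False
        \<comment> \<open>With C = 0 the bound \<open>*\<close> reads 2 t |B| <= A for all t; this t
          makes the left side 2 (A + 1).\<close>
        using *[of "(A + 1) / \<bar>B\<bar>"] True \<open>A \<ge> 0\<close> by simp
    qed
    then show ?thesis using True by simp
  next
    case False
    then have "C > 0" using \<open>C \<ge> 0\<close> by simp
    then show ?thesis
      \<comment> \<open>The optimal parameter, minimising A + t^2 C - 2 t |B|.\<close>
      using *[of "\<bar>B\<bar> / C"] by (simp add: power2_eq_square field_simps abs_mult_self_eq)
  qed
  then show ?thesis by (simp add: A_def B_def C_def)
qed

lemma set_integrable_box_if_square:
  fixes g :: "'a::euclidean_space \<Rightarrow> real"
  assumes "g \<in> borel_measurable borel" "integrable lborel (\<lambda>x. (g x)\<^sup>2)"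
  shows "set_integrable lborel (box a b) g"
proof -
  have "integrable lborel (\<lambda>x. indicator (box a b) x * g x)"
  proof (rule integrable_mult_square)
    have "integrable lborel (indicator (box a b) :: 'a \<Rightarrow> real)"
      by (intro integrable_real_indicator emeasure_lborel_box_finite) simp
    then show "integrable lborel (\<lambda>x. (indicator (box a b) x :: real)\<^sup>2)"
      by (simp add: indicator_square)
  qed (use assms in auto)
  then show ?thesis by (simp add: set_integrable_def)
qed

lemma fundamental_lemma_L2:
  assumes "g \<in> borel_measurable borel" "integrable lborel (\<lambda>x. (g x)\<^sup>2)"
    and "\<And>\<phi>. test_function \<phi> \<Longrightarrow> (\<integral>x. g x * \<phi> x \<partial>lborel) = 0"
  shows "AE x in lborel. g x = 0"
  using fundamental_lemma[of g] set_integrable_box_if_square assms by blast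

text \<open>Translation and Fubini arguments are carried out on \<open>lborel\<close> and need Borel
  measurability, whereas members of \<open>H\<close> are only Lebesgue measurable.\<close>

lemma square_integrable_borel_version:
  fixes u :: "real^3 \<Rightarrow> real"
  assumes "square_integrable u"
  obtains v where "v \<in> borel_measurable borel" "AE x in lebesgue. u x = v x"
    "integrable lborel (\<lambda>x. (v x)\<^sup>2)"
proof -
  have u [measurable]: "u \<in> borel_measurable lebesgue"
    and int: "integrable lebesgue (\<lambda>x. (u x)\<^sup>2)"
    using assms by (auto simp: square_integrable_def)
  obtain v where v: "v \<in> borel_measurable lborel" "AE x in lborel. u x = v x"
    using completion_ex_borel_measurable_real[OF u] by blast
  then have [measurable]: "v \<in> borel_measurable borel" by simp
  have ae: "AE x in lebesgue. u x = v x"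
    using v(2) by (rule AE_completion)
  have "integrable lebesgue (\<lambda>x. (v x)\<^sup>2)"
  proof (rule integrable_cong_AE_imp[OF int])
    show "AE x in lebesgue. (u x)\<^sup>2 = (v x)\<^sup>2"
      using ae by eventually_elim simp
    show "(\<lambda>x. (v x)\<^sup>2) \<in> borel_measurable lebesgue"
      by (intro borel_measurable_lebesgueI) measurable
  qed
  then have "integrable lborel (\<lambda>x. (v x)\<^sup>2)"
    by (subst (asm) integrable_completion) auto
  then show thesis using that[OF _ ae] \<open>v \<in> borel_measurable borel\<close> by blast
qed

lemma square_integrable_component:
  fixes G :: "real^3 \<Rightarrow> real^3"
  assumes "square_integrable G"
  shows "square_integrable (\<lambda>x. G x $ i)"
proof -
  have [measurable]: "G \<in> borel_measurable lebesgue"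
    using assms by (simp add: square_integrable_def)
  have "(\<lambda>x. G x $ i) \<in> borel_measurable lebesgue"
    by (rule borel_measurable_continuous_on[OF _ \<open>G \<in> _\<close>]) (intro continuous_intros)
  moreover have "integrable lebesgue (\<lambda>x. (G x $ i)\<^sup>2)"
  proof (rule Bochner_Integration.integrable_bound)
    show "integrable lebesgue (\<lambda>x. (norm (G x))\<^sup>2)"
      using assms by (simp add: square_integrable_def)
    show "AE x in lebesgue. norm ((G x $ i)\<^sup>2) \<le> norm ((norm (G x))\<^sup>2)"
    proof (rule AE_I2)
      show "norm ((G x $ i)\<^sup>2) \<le> norm ((norm (G x))\<^sup>2)" for x
        using power_mono[OF component_le_norm_cart[of "G x" i] abs_ge_zero, of 2] by simp
    qed
  qed (use \<open>(\<lambda>x. G x $ i) \<in> _\<close> in measurable)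
  ultimately show ?thesis by (simp add: square_integrable_def)
qed

lemma square_integrable_diff:
  fixes f g :: "real^3 \<Rightarrow> real"
  assumes "square_integrable f" "square_integrable g"
  shows "square_integrable (\<lambda>x. f x - g x)"
proof -
  have [measurable]: "f \<in> borel_measurable lebesgue" "g \<in> borel_measurable lebesgue"
    using assms by (auto simp: square_integrable_def)
  have "integrable lebesgue (\<lambda>x. f x * g x)"
    using assms by (intro integrable_mult_square) (auto simp: square_integrable_def)
  then have "integrable lebesgue (\<lambda>x. (f x)\<^sup>2 + (g x)\<^sup>2 - 2 * (f x * g x))"
    using assms by (intro Bochner_Integration.integrable_diff Bochner_Integration.integrable_add)
      (auto simp: square_integrable_def)
  then show ?thesis
    by (simp add: square_integrable_def power2_diff mult.assoc)
qed

lemma integrable_times_test_function: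
  assumes "square_integrable f" "test_function \<phi>"
  shows "integrable lebesgue (\<lambda>x. f x * \<phi> x)"
proof (rule integrable_mult_square)
  note [measurable] = test_function_measurable[OF assms(2)]
  show "\<phi> \<in> borel_measurable lebesgue" by (intro borel_measurable_lebesgueI) measurable
  show "integrable lebesgue (\<lambda>x. (\<phi> x)\<^sup>2)"
    using test_function_integrable_square[OF assms(2)] by (subst integrable_completion) auto
qed (use assms in \<open>auto simp: square_integrable_def\<close>)

lemma integral_borel_version:
  fixes u v w :: "'a::euclidean_space \<Rightarrow> real"
  assumes "AE x in lebesgue. u x = v x" "v \<in> borel_measurable borel" "w \<in> borel_measurable borel"
    "u \<in> borel_measurable lebesgue"
  shows "(\<integral>x. u x * w x \<partial>lebesgue) = (\<integral>x. v x * w x \<partial>lborel)"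
proof -
  note [measurable] = assms(2-4) assms(2,3)[THEN borel_measurable_lebesgueI]
  have "(\<integral>x. u x * w x \<partial>lebesgue) = (\<integral>x. v x * w x \<partial>lebesgue)"
    using assms(1) by (intro integral_cong_AE) auto
  also have "\<dots> = (\<integral>x. v x * w x \<partial>lborel)"
    by (rule integral_completion) measurable
  finally show ?thesis .
qed

text \<open>Each component of the difference integrates to 0 against every test function. This
  identifies the gradient chosen by \<open>SOME\<close> with one computed by hand.\<close>

lemma has_weak_gradient_unique:
  assumes "square_integrable G" "has_weak_gradient u G"
    and "square_integrable G'" "has_weak_gradient u G'"
  shows "AE x in lebesgue. G x = G' x"
proof -
  have "AE x in lebesgue. G x $ i = G' x $ i" for i
  proof -
    let ?D = "\<lambda>x. G x $ i - G' x $ i"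
    have comp: "square_integrable (\<lambda>x. G x $ i)" "square_integrable (\<lambda>x. G' x $ i)"
      using assms square_integrable_component by blast+
    then have D: "square_integrable ?D"
      by (rule square_integrable_diff)
    then obtain d where d: "d \<in> borel_measurable borel" "AE x in lebesgue. ?D x = d x"
      "integrable lborel (\<lambda>x. (d x)\<^sup>2)"
      using square_integrable_borel_version by blast
    have "AE x in lborel. d x = 0"
    proof (rule fundamental_lemma_L2[OF d(1,3)])
      fix \<phi> assume \<phi>: "test_function \<phi>"
      have "(\<integral>x. d x * \<phi> x \<partial>lborel) = (\<integral>x. ?D x * \<phi> x \<partial>lebesgue)"
        using D by (intro integral_borel_version[symmetric] d(1,2) test_function_measurable[OF \<phi>])
          (auto simp: square_integrable_def)
      also have "\<dots> = (\<integral>x. G x $ i * \<phi> x \<partial>lebesgue) - (\<integral>x. G' x $ i * \<phi> x \<partial>lebesgue)"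
        using comp[THEN integrable_times_test_function[OF _ \<phi>]] by (simp add: left_diff_distrib)
      also have "\<dots> = 0"
        using assms(2,4) \<phi> by (auto simp: has_weak_gradient_def)
      finally show "(\<integral>x. d x * \<phi> x \<partial>lborel) = 0" .
    qed
    then have "AE x in lebesgue. d x = 0" by (rule AE_completion)
    with d(2) show ?thesis by eventually_elim simp
  qed
  then have "AE x in lebesgue. \<forall>i. G x $ i = G' x $ i"
    by (simp add: AE_all_countable)
  then show ?thesis by eventually_elim (simp add: vec_eq_iff)
qed

section \<open>Difference quotients of weakly differentiable functions\<close>

lemma
  fixes w :: "real^3 \<Rightarrow> real" and h :: real
  assumes [measurable]: "w \<in> borel_measurable borel" and int: "integrable lborel (\<lambda>x. (w x)\<^sup>2)"
    and "h \<ge> 0"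
  shows integrable_pair_shift_square:
      "integrable (lborel \<Otimes>\<^sub>M lborel) (\<lambda>(s, x). (indicator {0..h} s * w (x + s *\<^sub>R a))\<^sup>2)" (is ?I)
    and integral_pair_shift_square:
      "(\<integral>x. (\<integral>s. (indicator {0..h} s * w (x + s *\<^sub>R a))\<^sup>2 \<partial>lborel) \<partial>lborel) = h * (\<integral>x. (w x)\<^sup>2 \<partial>lborel)" (is ?E)
proof -
  have int': "integrable lborel (\<lambda>x. (w (x + c))\<^sup>2)" for c
    using int lborel_integrable_translate[of "\<lambda>x. (w x)\<^sup>2" c] by simp
  have tr: "(\<integral>x. (w (x + c))\<^sup>2 \<partial>lborel) = (\<integral>x. (w x)\<^sup>2 \<partial>lborel)" for c
    using lborel_integral_translate[of "\<lambda>x. (w x)\<^sup>2" c] by simp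
  \<comment> \<open>By translation invariance the inner integral depends on s only through the
    indicator, so integrating in x first settles both claims.\<close>
  have eq: "(\<integral>x. (indicator {0..h} s * w (x + s *\<^sub>R a))\<^sup>2 \<partial>lborel) = indicator {0..h} s * (\<integral>x. (w x)\<^sup>2 \<partial>lborel)" for s
    by (simp add: power_mult_distrib indicator_square tr)
  show I: ?I
  proof (rule lborel_pair.Fubini_integrable)
    show "integrable lborel (\<lambda>s. \<integral>x. norm (case (s, x) of (s, x) \<Rightarrow> (indicator {0..h} s * w (x + s *\<^sub>R a))\<^sup>2) \<partial>lborel)"
      by (simp add: eq integrable_indicator_Icc)
    show "AE s in lborel. integrable lborel (\<lambda>x. case (s, x) of (s, x) \<Rightarrow> (indicator {0..h} s * w (x + s *\<^sub>R a))\<^sup>2)"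
      using int' by (simp add: power_mult_distrib)
  qed measurable
  from lborel_pair.Fubini_integral[OF I]
  show ?E using \<open>h \<ge> 0\<close> by (simp add: eq)
qed

text \<open>Justifies the exchanges of integrals in the next estimate, once with the shift on the
  first factor and once with it on the test function.\<close>

lemma integrable_pair_shift:
  fixes w \<psi> :: "real^3 \<Rightarrow> real" and h :: real
  assumes [measurable]: "w \<in> borel_measurable borel" "\<psi> \<in> borel_measurable borel"
    and int: "integrable lborel (\<lambda>x. (w x)\<^sup>2)" "integrable lborel (\<lambda>x. (\<psi> x)\<^sup>2)"
    and "h \<ge> 0"
  shows "integrable (lborel \<Otimes>\<^sub>M lborel) (\<lambda>(s, x). indicator {0..h} s * (w (x + s *\<^sub>R a) * \<psi> (x + s *\<^sub>R b)))"
proof -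
  have "integrable (lborel \<Otimes>\<^sub>M lborel) (\<lambda>z. (case z of (s, x) \<Rightarrow> indicator {0..h} s * w (x + s *\<^sub>R a))
      * (case z of (s, x) \<Rightarrow> indicator {0..h} s * \<psi> (x + s *\<^sub>R b)))"
    using integrable_pair_shift_square[OF _ int(1) \<open>h \<ge> 0\<close>, of a] integrable_pair_shift_square[OF _ int(2) \<open>h \<ge> 0\<close>, of b]
    by (intro integrable_mult_square) (auto simp: case_prod_unfold)
  also have "(\<lambda>z. (case z of (s, x) \<Rightarrow> indicator {0..h} s * w (x + s *\<^sub>R a))
      * (case z of (s, x) \<Rightarrow> indicator {0..h} s * \<psi> (x + s *\<^sub>R b)))
    = (\<lambda>(s, x). indicator {0..h} s * (w (x + s *\<^sub>R a) * \<psi> (x + s *\<^sub>R b)))"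
    by (auto simp: fun_eq_iff split: split_indicator)
  finally show ?thesis .
qed

text \<open>The line runs backwards because shifting a function by s e amounts, under the integral,
  to shifting the test function by -s e.\<close>

lemma test_function_FTC:
  assumes "test_function \<phi>" "h \<ge> 0"
  shows "(\<integral>s. indicator {0..h} s * partial i \<phi> (x + s *\<^sub>R (- axis i 1)) \<partial>lborel)
    = \<phi> x - \<phi> (x + h *\<^sub>R (- axis i 1))"
proof -
  let ?F = "\<lambda>s. - \<phi> (x + (- s) *\<^sub>R axis i 1)" and ?f = "\<lambda>s. partial i \<phi> (x + (- s) *\<^sub>R axis i 1)"
  have "(?F has_real_derivative ?f s) (at s)" for s
    using DERIV_chain2[OF line_derivative[OF test_function_differentiable[OF assms(1)], where x = x and t = "- s" and i = i]
        DERIV_minus[OF DERIV_ident]]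
    by (auto intro!: derivative_eq_intros)
  then have "(?F has_vector_derivative ?f s) (at s within {0..h})" for s
    by (meson has_field_derivative_at_within has_real_derivative_iff_has_vector_derivative)
  moreover have "continuous_on {0..h} ?f"
    by (rule continuous_on_compose2[OF test_function_continuous[OF test_function_partial[OF assms(1)], of UNIV]])
      (intro continuous_intros subset_UNIV)+
  ultimately have "(\<integral>s. indicator {0..h} s *\<^sub>R ?f s \<partial>lborel) = ?F h - ?F 0"
    using integral_FTC_atLeastAtMost[of 0 h ?F ?f] assms(2) by blast
  then show ?thesis by simp
qed

text \<open>The weak form of \<open>u(x + h e) - u(x) = \<integral>\<^sub>0\<^sup>h (\<partial>\<^sub>e u)(x + s e) ds\<close> and Jensen's inequality.\<close>

lemma L2_difference_le:
  fixes u g :: "real^3 \<Rightarrow> real"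
  assumes u [measurable]: "u \<in> borel_measurable borel" and g [measurable]: "g \<in> borel_measurable borel"
    and iu: "integrable lborel (\<lambda>x. (u x)\<^sup>2)" and ig: "integrable lborel (\<lambda>x. (g x)\<^sup>2)"
    and weak: "\<And>\<phi>. test_function \<phi> \<Longrightarrow>
      (\<integral>x. u x * partial i \<phi> x \<partial>lborel) = - (\<integral>x. g x * \<phi> x \<partial>lborel)"
    and h: "h > 0"
  shows "(\<integral>x. (u (x + h *\<^sub>R axis i 1) - u x)\<^sup>2 \<partial>lborel) \<le> h\<^sup>2 * (\<integral>x. (g x)\<^sup>2 \<partial>lborel)"
proof -
  let ?e = "axis i 1 :: real^3"
  define E where "E x = (\<integral>s. indicator {0..h} s * g (x + s *\<^sub>R ?e) \<partial>lborel)" for x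
  \<comment> \<open>The Jensen majorant of E^2: Cauchy-Schwarz on an interval of length
    \<open>h\<close> costs the factor \<open>h\<close>, and integrating in x gives a second
    one.\<close>
  define K where "K x = h * (\<integral>s. (indicator {0..h} s * g (x + s *\<^sub>R ?e))\<^sup>2 \<partial>lborel)" for x
  have [measurable]: "E \<in> borel_measurable borel"
    unfolding E_def by measurable
  have "h \<ge> 0" using h by simp
  note pair = integrable_pair_shift_square[OF g ig \<open>h \<ge> 0\<close>, of ?e]
  have intK: "integrable lborel K"
    unfolding K_def by (intro integrable_mult_right lborel_pair.integrable_snd[OF pair])
  have K: "(\<integral>x. K x \<partial>lborel) = h\<^sup>2 * (\<integral>x. (g x)\<^sup>2 \<partial>lborel)"
    unfolding K_def using integral_pair_shift_square[OF g ig \<open>h \<ge> 0\<close>, of ?e]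
    by (simp add: power2_eq_square)
  have EK: "AE x in lborel. (E x)\<^sup>2 \<le> K x"
    using lborel_pair.AE_integrable_snd[OF pair]
  proof eventually_elim
    case (elim x)
    \<comment> \<open>The indicator is written twice so that one copy can serve as the first
      function in Cauchy-Schwarz.\<close>
    have "(\<integral>s. indicator {0..h} s * (indicator {0..h} s * g (x + s *\<^sub>R ?e)) \<partial>lborel)\<^sup>2
      \<le> (\<integral>s. (indicator {0..h} s)\<^sup>2 \<partial>lborel) * (\<integral>s. (indicator {0..h} s * g (x + s *\<^sub>R ?e))\<^sup>2 \<partial>lborel)"
      by (rule Cauchy_Schwarz_integral) (use elim in \<open>auto simp: indicator_square integrable_indicator_Icc\<close>)
    then show ?case
      using h by (simp add: E_def K_def indicator_square mult.assoc[symmetric] indicator_times_eq_if(1)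
          flip: power2_eq_square)
  qed
  have intE: "integrable lborel (\<lambda>x. (E x)\<^sup>2)"
    using EK by (intro Bochner_Integration.integrable_bound[OF intK]) (auto elim!: eventually_mono)
  have int_shift: "integrable lborel (\<lambda>x. (u (x + c))\<^sup>2)" for c
    using iu lborel_integrable_translate[of "\<lambda>x. (u x)\<^sup>2" c] by simp
  let ?D = "\<lambda>x. u (x + h *\<^sub>R ?e) - u x"
  have intD: "integrable lborel (\<lambda>x. (?D x)\<^sup>2)"
    unfolding power2_diff mult.assoc
    by (intro Bochner_Integration.integrable_diff Bochner_Integration.integrable_add
        integrable_mult_right integrable_mult_square int_shift iu) measurable
  \<comment> \<open>Both functions are square integrable, so equality can be tested. Against a test
    function the shift is moved onto \<open>\<phi>\<close>, the weak derivative is used for each s,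
    and the s-integral is then evaluated by \<open>test_function_FTC\<close>.\<close>
  have "AE x in lborel. ?D x - E x = 0"
  proof (rule fundamental_lemma_L2)
    show "integrable lborel (\<lambda>x. (?D x - E x)\<^sup>2)"
      unfolding power2_diff[of "?D _"] mult.assoc
      by (intro Bochner_Integration.integrable_diff[OF Bochner_Integration.integrable_add]
          integrable_mult_right integrable_mult_square intD intE) measurable
    fix \<phi> assume \<phi>: "test_function \<phi>"
    note m [measurable] = test_function_measurable[OF \<phi>] test_function_measurable[OF test_function_partial[OF \<phi>]]
    note i\<phi> = test_function_integrable_square[OF \<phi>] test_function_integrable_square[OF test_function_partial[OF \<phi>], of i]
    have shift: "(\<integral>x. f (x + c) * \<phi> x \<partial>lborel) = (\<integral>x. f x * \<phi> (x + - c) \<partial>lborel)"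
      if "f \<in> borel_measurable borel" for f and c :: "real^3"
      using lborel_integral_translate[of "\<lambda>x. f (x + c) * \<phi> x" "- c"] that by simp
    have "(\<integral>x. E x * \<phi> x \<partial>lborel)
        = (\<integral>x. \<integral>s. indicator {0..h} s * (g (x + s *\<^sub>R ?e) * \<phi> x) \<partial>lborel \<partial>lborel)"
      unfolding E_def by (simp flip: integral_mult_left_zero add: mult.assoc)
    also have "\<dots> = (\<integral>s. \<integral>x. indicator {0..h} s * (g (x + s *\<^sub>R ?e) * \<phi> x) \<partial>lborel \<partial>lborel)"
      using integrable_pair_shift[OF g m(1) ig i\<phi>(1) \<open>h \<ge> 0\<close>, of ?e 0]
      by (intro lborel_pair.Fubini_integral) simp
    also have "\<dots> = (\<integral>s. \<integral>x. - (indicator {0..h} s * (u x * partial i \<phi> (x + s *\<^sub>R (- ?e)))) \<partial>lborel \<partial>lborel)"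
    proof (rule Bochner_Integration.integral_cong[OF refl])
      fix s :: real
      have eq: "partial i (\<lambda>x. \<phi> (x + s *\<^sub>R (- ?e))) = (\<lambda>x. partial i \<phi> (x + s *\<^sub>R (- ?e)))"
        using partial_translate(1)[OF test_function_differentiable[OF \<phi>]] by blast
      have "(\<integral>x. g (x + s *\<^sub>R ?e) * \<phi> x \<partial>lborel) = (\<integral>x. g x * \<phi> (x + s *\<^sub>R (- ?e)) \<partial>lborel)"
        using shift[OF g, of "s *\<^sub>R ?e"] by simp
      also have "\<dots> = - (\<integral>x. u x * partial i \<phi> (x + s *\<^sub>R (- ?e)) \<partial>lborel)"
        using weak[OF test_function_translate[OF \<phi>, of "s *\<^sub>R (- ?e)"]] unfolding eq by simp
      finally show "(\<integral>x. indicator {0..h} s * (g (x + s *\<^sub>R ?e) * \<phi> x) \<partial>lborel)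
        = (\<integral>x. - (indicator {0..h} s * (u x * partial i \<phi> (x + s *\<^sub>R (- ?e)))) \<partial>lborel)"
        by simp
    qed
    also have "\<dots> = - (\<integral>s. \<integral>x. indicator {0..h} s * (u x * partial i \<phi> (x + s *\<^sub>R (- ?e))) \<partial>lborel \<partial>lborel)"
      by (simp del: scaleR_minus_right)
    also have "(\<integral>s. \<integral>x. indicator {0..h} s * (u x * partial i \<phi> (x + s *\<^sub>R (- ?e))) \<partial>lborel \<partial>lborel)
      = (\<integral>x. \<integral>s. indicator {0..h} s * (u x * partial i \<phi> (x + s *\<^sub>R (- ?e))) \<partial>lborel \<partial>lborel)"
      using integrable_pair_shift[OF u m(2) iu i\<phi>(2) \<open>h \<ge> 0\<close>, of 0 "- ?e"]
      by (intro lborel_pair.Fubini_integral[symmetric]) simp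
    also have "\<dots> = (\<integral>x. u x * (\<phi> x - \<phi> (x + h *\<^sub>R (- ?e))) \<partial>lborel)"
      by (subst test_function_FTC[OF \<phi> \<open>h \<ge> 0\<close>, symmetric])
        (simp add: mult.left_commute del: scaleR_minus_right)
    also have "\<dots> = (\<integral>x. u x * \<phi> x \<partial>lborel) - (\<integral>x. u x * \<phi> (x + h *\<^sub>R (- ?e)) \<partial>lborel)"
      unfolding right_diff_distrib
      using test_function_integrable_square[OF test_function_translate[OF \<phi>]]
      by (intro Bochner_Integration.integral_diff integrable_mult_square iu i\<phi>) measurable
    also have "(\<integral>x. u x * \<phi> (x + h *\<^sub>R (- ?e)) \<partial>lborel) = (\<integral>x. u (x + h *\<^sub>R ?e) * \<phi> x \<partial>lborel)"
      using shift[OF u, of "h *\<^sub>R ?e"] by simp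
    finally have *: "(\<integral>x. E x * \<phi> x \<partial>lborel) = (\<integral>x. u (x + h *\<^sub>R ?e) * \<phi> x \<partial>lborel) - (\<integral>x. u x * \<phi> x \<partial>lborel)"
      by simp
    have "integrable lborel (\<lambda>x. E x * \<phi> x)" "integrable lborel (\<lambda>x. u (x + h *\<^sub>R ?e) * \<phi> x)"
      "integrable lborel (\<lambda>x. u x * \<phi> x)"
      by (intro integrable_mult_square intE int_shift iu i\<phi>; measurable)+
    then show "(\<integral>x. (?D x - E x) * \<phi> x \<partial>lborel) = 0"
      using * by (simp add: left_diff_distrib)
  qed measurable
  then have "AE x in lborel. (?D x)\<^sup>2 \<le> K x"
    using EK by eventually_elim auto
  then have "(\<integral>x. (?D x)\<^sup>2 \<partial>lborel) \<le> (\<integral>x. K x \<partial>lborel)"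
    by (intro integral_mono_AE intD intK)
  then show ?thesis by (simp add: K)
qed

text \<open>The uncertainty principle, with difference quotients in place of derivatives: for
  \<open>y = x\<^sub>i u\<close> one has \<open>h \<integral> u u(\<cdot> + h e) = - \<integral> y (u(\<cdot> + h e) - u(\<cdot> - h e))\<close>.\<close>

lemma oscillator_bound_borel:
  fixes u g :: "real^3 \<Rightarrow> real"
  assumes u [measurable]: "u \<in> borel_measurable borel" and g [measurable]: "g \<in> borel_measurable borel"
    and iu: "integrable lborel (\<lambda>x. (u x)\<^sup>2)" and ig: "integrable lborel (\<lambda>x. (g x)\<^sup>2)"
    and weak: "\<And>\<phi>. test_function \<phi> \<Longrightarrow>
      (\<integral>x. u x * partial i \<phi> x \<partial>lborel) = - (\<integral>x. g x * \<phi> x \<partial>lborel)"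
    and iy: "integrable lborel (\<lambda>x. (x $ i * u x)\<^sup>2)"
  shows "(\<integral>x. (u x)\<^sup>2 \<partial>lborel) \<le> (\<integral>x. (g x)\<^sup>2 \<partial>lborel) + (\<integral>x. (x $ i * u x)\<^sup>2 \<partial>lborel)"
proof -
  let ?e = "axis i 1 :: real^3"
  define U G Y where "U = (\<integral>x. (u x)\<^sup>2 \<partial>lborel)" and "G = (\<integral>x. (g x)\<^sup>2 \<partial>lborel)"
    and "Y = (\<integral>x. (x $ i * u x)\<^sup>2 \<partial>lborel)"
  have [measurable]: "(\<lambda>x::real^3. x $ i) \<in> borel_measurable borel"
    by (intro borel_measurable_continuous_onI continuous_intros)
  \<comment> \<open>For fixed \<open>h\<close> the uncertainty principle holds up to an error of
    order h^2, which is removed at the end by letting h tend to 0.\<close>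
  have "U \<le> G + Y + h\<^sup>2 * G" if h: "h > 0" for h
  proof -
    let ?p = "\<lambda>x. u (x + h *\<^sub>R ?e)" and ?m = "\<lambda>x. u (x + - (h *\<^sub>R ?e))" and ?y = "\<lambda>x. x $ i * u x"
    have neg_le: "- (2 * z) \<le> 2 * \<bar>z\<bar>" for z :: real by simp
    have int_shift: "integrable lborel (\<lambda>x. (u (x + c))\<^sup>2)" for c
      using iu lborel_integrable_translate[of "\<lambda>x. (u x)\<^sup>2" c] by simp
    have eq_shift: "(\<integral>x. (u (x + c))\<^sup>2 \<partial>lborel) = U" for c
      using lborel_integral_translate[of "\<lambda>x. (u x)\<^sup>2" c] by (simp add: U_def)
    have prod: "integrable lborel (\<lambda>x. u x * ?p x)" "integrable lborel (\<lambda>x. ?y x * ?p x)"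
      "integrable lborel (\<lambda>x. ?y x * ?m x)" "integrable lborel (\<lambda>x. ?p x * ?m x)"
      by (intro integrable_mult_square int_shift iu iy; measurable)+
    have W: "(\<integral>x. (?p x - ?m x)\<^sup>2 \<partial>lborel) \<le> (2 * h)\<^sup>2 * G"
    proof -
      \<comment> \<open>The symmetric difference is, after a translation by h, a one-sided
        difference with step 2h.\<close>
      have "(\<integral>x. (?p x - ?m x)\<^sup>2 \<partial>lborel) = (\<integral>x. (u (x + (2 * h) *\<^sub>R ?e) - u x)\<^sup>2 \<partial>lborel)"
        by (subst lborel_integral_translate[of "\<lambda>x. (?p x - ?m x)\<^sup>2" "h *\<^sub>R ?e", symmetric])
          (simp_all add: add.assoc flip: scaleR_add_left)
      also have "\<dots> \<le> (2 * h)\<^sup>2 * G"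
        unfolding G_def by (rule L2_difference_le[OF u g iu ig weak]) (use h in auto)
      finally show ?thesis .
    qed
    have intW: "integrable lborel (\<lambda>x. (?p x - ?m x)\<^sup>2)"
      unfolding power2_diff mult.assoc
      by (intro Bochner_Integration.integrable_diff Bochner_Integration.integrable_add
          integrable_mult_right int_shift prod)
    have "(\<integral>x. ?y x * ?m x \<partial>lborel) = (\<integral>x. ?y (x + h *\<^sub>R ?e) * u x \<partial>lborel)"
      by (subst lborel_integral_translate[of "\<lambda>x. ?y x * ?m x" "h *\<^sub>R ?e", symmetric]) simp_all
    \<comment> \<open>The shifted weight is x_i + h. The extra h is the discrete form of the
      commutator of the derivative and x_i being 1.\<close>
    also have "\<dots> = (\<integral>x. ?y x * ?p x + h * (u x * ?p x) \<partial>lborel)"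
      by (intro Bochner_Integration.integral_cong) (auto simp: algebra_simps)
    also have "\<dots> = (\<integral>x. ?y x * ?p x \<partial>lborel) + h * (\<integral>x. u x * ?p x \<partial>lborel)"
      using prod by simp
    finally have "h * (\<integral>x. u x * ?p x \<partial>lborel) = - (\<integral>x. ?y x * (?p x - ?m x) \<partial>lborel)"
      using prod by (simp add: right_diff_distrib)
    also have "(\<integral>x. ?y x * (?p x - ?m x) \<partial>lborel) = (\<integral>x. (2 * h) * (?y x * ((?p x - ?m x) / (2 * h))) \<partial>lborel)"
      using h by (intro Bochner_Integration.integral_cong) auto
    also have "- \<dots> = h * - (2 * (\<integral>x. ?y x * ((?p x - ?m x) / (2 * h)) \<partial>lborel))"
      by (subst integral_mult_right_zero) simp
    finally have "(\<integral>x. u x * ?p x \<partial>lborel) = - (2 * (\<integral>x. ?y x * ((?p x - ?m x) / (2 * h)) \<partial>lborel))"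
      by (subst (asm) mult_left_cancel) (use h in auto)
    also have "\<dots> \<le> 2 * \<bar>\<integral>x. ?y x * ((?p x - ?m x) / (2 * h)) \<partial>lborel\<bar>"
      by (rule neg_le)
    also have "\<dots> \<le> Y + (\<integral>x. ((?p x - ?m x) / (2 * h))\<^sup>2 \<partial>lborel)"
      unfolding Y_def by (rule integral_mult_square_le) (use iy intW in \<open>auto simp: power_divide\<close>)
    also have "(\<integral>x. ((?p x - ?m x) / (2 * h))\<^sup>2 \<partial>lborel) = (\<integral>x. (?p x - ?m x)\<^sup>2 \<partial>lborel) / (2 * h)\<^sup>2"
      by (simp add: power_divide)
    also have "\<dots> \<le> G"
      using W h by (simp add: divide_le_eq mult.commute)
    finally have 1: "(\<integral>x. u x * ?p x \<partial>lborel) \<le> Y + G" by simp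
    \<comment> \<open>Polarisation: the correlation of \<open>u\<close> with its shift differs from
      \<open>U\<close> only by half the squared L2 norm of the difference, which is of order
      h^2.\<close>
    have "(\<integral>x. (?p x - u x)\<^sup>2 \<partial>lborel) = 2 * U - 2 * (\<integral>x. u x * ?p x \<partial>lborel)"
    proof -
      have "(?p x - u x)\<^sup>2 = (?p x)\<^sup>2 + (u x)\<^sup>2 - 2 * (u x * ?p x)" for x
        by (simp add: power2_diff)
      then have "(\<integral>x. (?p x - u x)\<^sup>2 \<partial>lborel) = (\<integral>x. (?p x)\<^sup>2 + (u x)\<^sup>2 - 2 * (u x * ?p x) \<partial>lborel)"
        by presburger
      also have "\<dots> = U + U - 2 * (\<integral>x. u x * ?p x \<partial>lborel)"
        using int_shift[of "h *\<^sub>R ?e"] iu prod(1) eq_shift[of "h *\<^sub>R ?e"] by (simp add: U_def)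
      finally show ?thesis by simp
    qed
    moreover have "(\<integral>x. (?p x - u x)\<^sup>2 \<partial>lborel) \<le> h\<^sup>2 * G"
      unfolding G_def by (rule L2_difference_le[OF u g iu ig weak h])
    moreover have "0 \<le> h\<^sup>2 * G" by (simp add: G_def)
    ultimately show ?thesis using 1 by linarith
  qed
  moreover have "((\<lambda>h. G + Y + h\<^sup>2 * G) \<longlongrightarrow> G + Y + 0\<^sup>2 * G) (at_right 0)"
    by (intro tendsto_intros)
  ultimately have "U \<le> G + Y + 0\<^sup>2 * G"
    by (intro tendsto_lowerbound[where F = "at_right (0::real)"]) (auto simp: eventually_at_right_field intro: exI[of _ 1])
  then show ?thesis by (simp add: U_def G_def Y_def)
qed

section \<open>Lower bound for the quadratic form\<close>

lemma square_integrable_weak_gradient: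
  assumes "u \<in> H1"
  shows "square_integrable (weak_gradient u)" "has_weak_gradient u (weak_gradient u)"
proof -
  have "\<exists>G. square_integrable G \<and> has_weak_gradient u G"
    using assms by (simp add: H1_def)
  from someI_ex[OF this] show "square_integrable (weak_gradient u)" "has_weak_gradient u (weak_gradient u)"
    by (simp_all add: weak_gradient_def)
qed

lemma norm_square_vec3: "(norm (x :: real^3))\<^sup>2 = (x $ 1)\<^sup>2 + (x $ 2)\<^sup>2 + (x $ 3)\<^sup>2"
  unfolding power2_norm_eq_inner inner_vec_def sum_3 by (simp add: power2_eq_square)

lemma oscillator_bound:
  assumes u: "square_integrable u" and G: "square_integrable G" "has_weak_gradient u G"
    and iy: "integrable lebesgue (\<lambda>x. (x $ i * u x)\<^sup>2)"
  shows "(\<integral>x. (u x)\<^sup>2 \<partial>lebesgue) \<le> (\<integral>x. (G x $ i)\<^sup>2 \<partial>lebesgue) + (\<integral>x. (x $ i * u x)\<^sup>2 \<partial>lebesgue)"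
proof -
  obtain v where v: "v \<in> borel_measurable borel" "AE x in lebesgue. u x = v x"
    "integrable lborel (\<lambda>x. (v x)\<^sup>2)"
    using square_integrable_borel_version[OF u] by blast
  note Gi = square_integrable_component[OF G(1), of i]
  obtain g where g: "g \<in> borel_measurable borel" "AE x in lebesgue. G x $ i = g x"
    "integrable lborel (\<lambda>x. (g x)\<^sup>2)"
    using square_integrable_borel_version[OF Gi] by blast
  have um: "u \<in> borel_measurable lebesgue" "(\<lambda>x. G x $ i) \<in> borel_measurable lebesgue"
    using u Gi by (auto simp: square_integrable_def)
  have [measurable]: "(\<lambda>x::real^3. x $ i) \<in> borel_measurable borel"
    by (intro borel_measurable_continuous_onI continuous_intros)
  have xm: "(\<lambda>x::real^3. x $ i) \<in> borel_measurable lebesgue"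
    by (rule borel_measurable_lebesgueI) measurable
  note [measurable] = v(1) g(1)
  have weak: "(\<integral>x. v x * partial i \<phi> x \<partial>lborel) = - (\<integral>x. g x * \<phi> x \<partial>lborel)" if \<phi>: "test_function \<phi>" for \<phi>
  proof -
    have "(\<integral>x. u x * partial i \<phi> x \<partial>lebesgue) = - (\<integral>x. G x $ i * \<phi> x \<partial>lebesgue)"
      using G(2) \<phi> by (simp add: has_weak_gradient_def)
    then show ?thesis
      by (simp only: integral_borel_version[OF v(2,1) test_function_measurable[OF test_function_partial[OF \<phi>]] um(1)]
          integral_borel_version[OF g(2,1) test_function_measurable[OF \<phi>] um(2)])
  qed
  have ae: "AE x in lebesgue. (x $ i * u x)\<^sup>2 = (x $ i * v x)\<^sup>2" "AE x in lebesgue. (u x)\<^sup>2 = (v x)\<^sup>2"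
    "AE x in lebesgue. (G x $ i)\<^sup>2 = (g x)\<^sup>2"
    using v(2) g(2) by auto
  have m: "(\<lambda>x. (x $ i * v x)\<^sup>2) \<in> borel_measurable lebesgue" "(\<lambda>x. (v x)\<^sup>2) \<in> borel_measurable lebesgue"
    "(\<lambda>x. (g x)\<^sup>2) \<in> borel_measurable lebesgue"
    by (intro borel_measurable_lebesgueI; measurable)+
  have m': "(\<lambda>x. (x $ i * u x)\<^sup>2) \<in> borel_measurable lebesgue" "(\<lambda>x. (u x)\<^sup>2) \<in> borel_measurable lebesgue"
    "(\<lambda>x. (G x $ i)\<^sup>2) \<in> borel_measurable lebesgue"
    using um xm by (auto intro!: borel_measurable_power borel_measurable_times)
  have eq: "(\<integral>x. (x $ i * u x)\<^sup>2 \<partial>lebesgue) = (\<integral>x. (x $ i * v x)\<^sup>2 \<partial>lborel)"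
      "(\<integral>x. (u x)\<^sup>2 \<partial>lebesgue) = (\<integral>x. (v x)\<^sup>2 \<partial>lborel)"
      "(\<integral>x. (G x $ i)\<^sup>2 \<partial>lebesgue) = (\<integral>x. (g x)\<^sup>2 \<partial>lborel)"
    by (subst integral_cong_AE[OF m'(1) m(1) ae(1)] integral_cong_AE[OF m'(2) m(2) ae(2)]
        integral_cong_AE[OF m'(3) m(3) ae(3)], rule integral_completion, measurable)+
  have "integrable lebesgue (\<lambda>x. (x $ i * v x)\<^sup>2)"
    by (rule integrable_cong_AE_imp[OF iy m(1) ae(1)])
  then have "integrable lborel (\<lambda>x. (x $ i * v x)\<^sup>2)"
    by (subst (asm) integrable_completion) auto
  then show ?thesis
    unfolding eq by (intro oscillator_bound_borel v g weak)
qed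

lemma potential_measurable [measurable]: "potential \<in> borel_measurable borel"
  unfolding potential_def[abs_def] by (intro borel_measurable_continuous_onI continuous_intros)

lemma quad_form_eq:
  assumes "u \<in> H"
  shows "quad_form \<mu> u = (\<integral>x. (norm (weak_gradient u x))\<^sup>2 \<partial>lebesgue)
    + (\<integral>x. potential x * (u x)\<^sup>2 \<partial>lebesgue) - \<mu> * (\<integral>x. (u x)\<^sup>2 \<partial>lebesgue)"
proof -
  have "square_integrable (weak_gradient u)" "square_integrable u" "integrable lebesgue (\<lambda>x. potential x * (u x)\<^sup>2)"
    using assms square_integrable_weak_gradient(1)[of u] by (auto simp: H_def H1_def)
  then have "integrable lebesgue (\<lambda>x. (norm (weak_gradient u x))\<^sup>2)" "integrable lebesgue (\<lambda>x. (u x)\<^sup>2)"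
    "integrable lebesgue (\<lambda>x. potential x * (u x)\<^sup>2)"
    by (auto simp: square_integrable_def)
  then show ?thesis
    by (simp add: quad_form_def left_diff_distrib)
qed

text \<open>The oscillators in the directions 1 and 2 contribute 1 each; the derivative in the free
  direction 3 only adds a nonnegative term.\<close>

lemma quad_form_lower_bound:
  assumes "u \<in> H"
  shows "(2 - \<mu>) * (norm_L2 u)\<^sup>2 \<le> quad_form \<mu> u"
proof -
  let ?G = "weak_gradient u"
  have "u \<in> H1" and u: "square_integrable u" and iV: "integrable lebesgue (\<lambda>x. potential x * (u x)\<^sup>2)"
    using assms by (auto simp: H_def H1_def)
  note G = square_integrable_weak_gradient[OF \<open>u \<in> H1\<close>]
  have um: "u \<in> borel_measurable lebesgue"
    using u by (simp add: square_integrable_def)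
  have iG: "integrable lebesgue (\<lambda>x. (?G x $ i)\<^sup>2)" for i
    using square_integrable_component[OF G(1), of i] by (simp add: square_integrable_def)
  have iy: "integrable lebesgue (\<lambda>x. (x $ i * u x)\<^sup>2)" if "i = 1 \<or> i = 2" for i
  proof (rule Bochner_Integration.integrable_bound[OF iV])
    have "(\<lambda>x::real^3. x $ i) \<in> borel_measurable lebesgue"
      by (intro borel_measurable_lebesgueI borel_measurable_continuous_onI continuous_intros)
    then show "(\<lambda>x. (x $ i * u x)\<^sup>2) \<in> borel_measurable lebesgue"
      using um by (auto intro!: borel_measurable_power borel_measurable_times)
    show "AE x in lebesgue. norm ((x $ i * u x)\<^sup>2) \<le> norm (potential x * (u x)\<^sup>2)"
      using that by (auto simp: power_mult_distrib potential_def abs_mult intro!: mult_right_mono)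
  qed
  have U: "(norm_L2 u)\<^sup>2 = (\<integral>x. (u x)\<^sup>2 \<partial>lebesgue)"
    by (simp add: norm_L2_def)
  have "2 * (norm_L2 u)\<^sup>2 \<le> (\<integral>x. (?G x $ 1)\<^sup>2 \<partial>lebesgue) + (\<integral>x. (?G x $ 2)\<^sup>2 \<partial>lebesgue)
      + ((\<integral>x. (x $ 1 * u x)\<^sup>2 \<partial>lebesgue) + (\<integral>x. (x $ 2 * u x)\<^sup>2 \<partial>lebesgue))"
    using oscillator_bound[OF u G iy, of 1] oscillator_bound[OF u G iy, of 2] unfolding U by simp
  also have "(\<integral>x. (x $ 1 * u x)\<^sup>2 \<partial>lebesgue) + (\<integral>x. (x $ 2 * u x)\<^sup>2 \<partial>lebesgue) = (\<integral>x. potential x * (u x)\<^sup>2 \<partial>lebesgue)"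
    using iy[of 1] iy[of 2]
    by (subst Bochner_Integration.integral_add[symmetric]) (simp_all add: potential_def power_mult_distrib distrib_right)
  also have "(\<integral>x. (?G x $ 1)\<^sup>2 \<partial>lebesgue) + (\<integral>x. (?G x $ 2)\<^sup>2 \<partial>lebesgue) = (\<integral>x. (?G x $ 1)\<^sup>2 + (?G x $ 2)\<^sup>2 \<partial>lebesgue)"
    using iG by simp
  also have "\<dots> \<le> (\<integral>x. (norm (?G x))\<^sup>2 \<partial>lebesgue)"
    using iG G(1) by (intro integral_mono) (auto simp: norm_square_vec3 square_integrable_def)
  finally show ?thesis
    unfolding quad_form_eq[OF assms] U by (simp add: left_diff_distrib)
qed

subsection \<open>Gaussians\<close>

text \<open>With the factor 1/2 in the exponent, coefficient 1 gives the ground state exp (-t^2/2)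
  of the one-dimensional oscillator -d^2/dt^2 + t^2, with eigenvalue 1.\<close>

definition gauss :: "(3 \<Rightarrow> real) \<Rightarrow> real^3 \<Rightarrow> real" where
  "gauss c x = exp (- (\<Sum>i\<in>UNIV. c i * (x $ i)\<^sup>2) / 2)"

lemma gauss_pos: "gauss c x > 0"
  by (simp add: gauss_def)

lemma gauss_powr: "gauss c x powr q = gauss (\<lambda>i. q * c i) x"
  by (simp add: gauss_def powr_def sum_distrib_left mult.assoc)

lemma gauss_power2: "(gauss c x)\<^sup>2 = gauss (\<lambda>i. 2 * c i) x"
  using gauss_powr[of c x 2] gauss_pos[of c x] by simp

lemma gauss_prod: "gauss c x = (\<Prod>i\<in>UNIV. exp (- c i * (x $ i)\<^sup>2 / 2))"
  by (simp add: gauss_def sum_negf[symmetric] sum_divide_distrib exp_sum)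

text \<open>\<open>lborel\<close> is the image of the product measure indexed by
  \<open>Basis\<close>; reindexing \<open>Basis\<close> by coordinates turns the Fubini theorem for
  finite products into this form.\<close>

lemma
  fixes f :: "'n::finite \<Rightarrow> real \<Rightarrow> real"
  assumes int: "\<And>i. integrable lborel (f i)"
  shows integrable_prod_vec: "integrable lborel (\<lambda>x::real^'n. \<Prod>i\<in>UNIV. f i (x $ i))" (is ?I)
    and integral_prod_vec:
      "(\<integral>x. (\<Prod>i\<in>UNIV. f i ((x::real^'n) $ i)) \<partial>lborel) = (\<Prod>i\<in>UNIV. \<integral>t. f i t \<partial>lborel)" (is ?E)
proof -
  interpret product_sigma_finite "\<lambda>b::real^'n. lborel :: real measure" ..
  let ?B = "Basis :: (real^'n) set"
  let ?T = "\<lambda>y. \<Sum>b\<in>?B. y b *\<^sub>R b" and ?F = "\<lambda>x::real^'n. \<Prod>i\<in>UNIV. f i (x $ i)"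
  have B: "?B = (\<lambda>i. axis i 1) ` UNIV"
    by (auto simp: Basis_vec_def)
  have inj: "inj (\<lambda>i::'n. axis i (1::real))"
    by (auto simp: inj_def axis_eq_axis)
  have re: "(\<Prod>b\<in>?B. h (axis_index b) b) = (\<Prod>i\<in>UNIV. h i (axis i 1))" for h :: "'n \<Rightarrow> real^'n \<Rightarrow> real"
    unfolding B prod.reindex[OF inj] by simp
  have [measurable]: "f i \<in> borel_measurable borel" for i
    using borel_measurable_integrable[OF int[of i]] by simp
  have [measurable]: "(\<lambda>x::real^'n. x $ i) \<in> borel_measurable borel" for i
    by (intro borel_measurable_continuous_onI continuous_intros)
  have F [measurable]: "?F \<in> borel_measurable borel" by measurable
  have T [measurable]: "?T \<in> (\<Pi>\<^sub>M b\<in>?B. lborel) \<rightarrow>\<^sub>M borel" by measurable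
  have "?T y $ i = y (axis i 1)" for y i
    using inner_sum_left_Basis[of "axis i 1 :: real^'n" y]
    by (simp add: cart_eq_inner_axis axis_in_Basis_iff)
  then have FT: "?F (?T y) = (\<Prod>b\<in>?B. f (axis_index b) (y b))" for y
    using re[of "\<lambda>i b. f i (y b)"] by simp
  have "integrable (\<Pi>\<^sub>M b\<in>?B. lborel) (\<lambda>y. \<Prod>b\<in>?B. f (axis_index b) (y b))"
    by (intro product_integrable_prod int) simp
  then have "integrable (distr (\<Pi>\<^sub>M b\<in>?B. lborel) borel ?T) ?F"
    unfolding integrable_distr_eq[OF T F] FT .
  then show ?I
    by (subst lborel_eq)
  have "(\<integral>x. ?F x \<partial>lborel) = (\<integral>y. ?F (?T y) \<partial>(\<Pi>\<^sub>M b\<in>?B. lborel))"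
    by (subst lborel_eq, rule integral_distr) measurable
  also have "\<dots> = (\<Prod>b\<in>?B. \<integral>t. f (axis_index b) t \<partial>lborel)"
    unfolding FT by (intro product_integral_prod int) simp
  also have "\<dots> = (\<Prod>i\<in>UNIV. \<integral>t. f i t \<partial>lborel)"
    using re[of "\<lambda>i b. \<integral>t. f i t \<partial>lborel"] .
  finally show ?E .
qed

text \<open>Moments of order 0 and 2 of the centred normal density with standard deviation 1 / sqrt
  c, multiplied by its normalising constant.\<close>

lemma gaussian_integrals:
  fixes c :: real
  assumes "c > 0"
  shows "has_bochner_integral lborel (\<lambda>x. exp (- c * x\<^sup>2 / 2)) (sqrt (2 * pi / c))"
    and "has_bochner_integral lborel (\<lambda>x. x\<^sup>2 * exp (- c * x\<^sup>2 / 2)) (sqrt (2 * pi / c) / c)"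
proof -
  let ?s = "1 / sqrt c"
  have s: "?s > 0" using assms by simp
  have eq: "normal_density 0 ?s x * sqrt (2 * pi / c) = exp (- c * x\<^sup>2 / 2)" for x
    using assms by (simp add: normal_density_def power_divide mult.commute)
  have "has_bochner_integral lborel (\<lambda>x. normal_density 0 ?s x * (x - 0) ^ (2 * 0) * sqrt (2 * pi / c))
      (fact (2 * 0) / ((2 / ?s\<^sup>2) ^ 0 * fact 0) * sqrt (2 * pi / c))"
    by (intro has_bochner_integral_mult_left normal_moment_even s)
  then show "has_bochner_integral lborel (\<lambda>x. exp (- c * x\<^sup>2 / 2)) (sqrt (2 * pi / c))"
    by (simp add: eq)
  have "has_bochner_integral lborel (\<lambda>x. normal_density 0 ?s x * (x - 0) ^ (2 * 1) * sqrt (2 * pi / c))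
      (fact (2 * 1) / ((2 / ?s\<^sup>2) ^ 1 * fact 1) * sqrt (2 * pi / c))"
    by (intro has_bochner_integral_mult_left normal_moment_even s)
  also have "(\<lambda>x. normal_density 0 ?s x * (x - 0) ^ (2 * 1) * sqrt (2 * pi / c)) = (\<lambda>x. x\<^sup>2 * exp (- c * x\<^sup>2 / 2))"
    unfolding eq[symmetric] by (simp add: mult_ac)
  also have "fact (2 * 1) / ((2 / ?s\<^sup>2) ^ 1 * fact 1) * sqrt (2 * pi / c) = sqrt (2 * pi / c) / c"
    using assms by (simp add: power_divide)
  finally show "has_bochner_integral lborel (\<lambda>x. x\<^sup>2 * exp (- c * x\<^sup>2 / 2)) (sqrt (2 * pi / c) / c)" .
qed

definition gauss_integral :: "(3 \<Rightarrow> real) \<Rightarrow> real" where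
  "gauss_integral c = (\<Prod>i\<in>UNIV. sqrt (2 * pi / c i))"

lemma gauss_integral_pos: "(\<And>i. c i > 0) \<Longrightarrow> gauss_integral c > 0"
  unfolding gauss_integral_def by (intro prod_pos) auto

lemma gauss_continuous: "continuous_on S (gauss c)"
  unfolding gauss_def[abs_def] by (intro continuous_intros) auto

lemma gauss_measurable [measurable]: "gauss c \<in> borel_measurable borel"
  by (intro borel_measurable_continuous_onI gauss_continuous)

lemma has_integral_gauss:
  assumes c: "\<And>i. c i > 0"
  shows "has_bochner_integral lebesgue (gauss c) (gauss_integral c)"
    and "has_bochner_integral lebesgue (\<lambda>x. (x $ j)\<^sup>2 * gauss c x) (gauss_integral c / c j)"
proof -
  let ?e = "\<lambda>i t. exp (- c i * t\<^sup>2 / 2)"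
  note I = gaussian_integrals[OF c]
  have meas [measurable]: "(\<lambda>x::real^3. x $ j) \<in> borel_measurable borel"
    by (intro borel_measurable_continuous_onI continuous_intros)
  have 0: "has_bochner_integral lborel (gauss c) (gauss_integral c)"
    using integrable_prod_vec[of ?e] integral_prod_vec[of ?e] I(1)
    by (simp add: has_bochner_integral_iff gauss_prod[abs_def] gauss_integral_def)
  then show "has_bochner_integral lebesgue (gauss c) (gauss_integral c)"
    by (simp add: has_bochner_integral_iff integrable_completion integral_completion)
  \<comment> \<open>The square of coordinate \<open>j\<close> is absorbed into the
    \<open>j\<close>-th factor, so the integrand stays a product.\<close>
  define f where "f i = (if i = j then (\<lambda>t. t\<^sup>2 * ?e i t) else ?e i)" for i
  have f: "integrable lborel (f i)" for i
    using I by (simp add: f_def has_bochner_integral_iff)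
  have "(\<Prod>i\<in>UNIV. f i (x $ i)) = (\<Prod>i\<in>UNIV. (if i = j then (x $ j)\<^sup>2 else 1) * ?e i (x $ i))" for x :: "real^3"
    by (intro prod.cong) (auto simp: f_def)
  also have "\<dots> x = (x $ j)\<^sup>2 * gauss c x" for x :: "real^3"
    by (simp add: prod.distrib gauss_prod)
  finally have fx: "(\<Prod>i\<in>UNIV. f i (x $ i)) = (x $ j)\<^sup>2 * gauss c x" for x :: "real^3" .
  have "(\<Prod>i\<in>UNIV. \<integral>t. f i t \<partial>lborel) = (\<Prod>i\<in>UNIV. (if i = j then 1 / c j else 1) * sqrt (2 * pi / c i))"
    by (intro prod.cong) (use I in \<open>auto simp: f_def has_bochner_integral_iff\<close>)
  also have "\<dots> = gauss_integral c / c j"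
    by (simp add: prod.distrib gauss_integral_def)
  finally have "has_bochner_integral lborel (\<lambda>x. (x $ j)\<^sup>2 * gauss c x) (gauss_integral c / c j)"
    using integrable_prod_vec[of f, OF f] integral_prod_vec[of f, OF f]
    by (simp add: has_bochner_integral_iff fx)
  then show "has_bochner_integral lebesgue (\<lambda>x. (x $ j)\<^sup>2 * gauss c x) (gauss_integral c / c j)"
    by (simp add: has_bochner_integral_iff integrable_completion integral_completion)
qed

section \<open>Derivatives and energies of Gaussians\<close>

lemma gauss_has_derivative:
  "(gauss c has_derivative (\<lambda>h. gauss c x * - (\<Sum>i\<in>UNIV. c i * x $ i * h $ i))) (at x)"
proof -
  have "((\<lambda>x. - (\<Sum>i\<in>UNIV. c i * (x $ i)\<^sup>2) / 2) has_derivative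
      (\<lambda>h. - (\<Sum>i\<in>UNIV. c i * x $ i * h $ i))) (at x)"
    by (auto intro!: derivative_eq_intros bounded_linear.has_derivative[OF bounded_linear_vec_nth]
        simp: fun_eq_iff sum_distrib_left mult_ac)
  from has_derivative_exp[OF this] show ?thesis
    unfolding gauss_def[abs_def] by (simp add: mult.commute)
qed

lemma sum_axis: "(\<Sum>i\<in>UNIV. f i * axis j (1::real) $ i) = f j"
  by (simp add: axis_def if_distrib cong: if_cong)

lemma gauss_differentiable: "gauss c differentiable (at x)"
  using gauss_has_derivative by (auto simp: differentiable_def)

lemma partial_gauss: "partial i (gauss c) = (\<lambda>x. - (c i * x $ i * gauss c x))"
  by (rule ext, subst partial_eqI[OF gauss_has_derivative]) (simp add: sum_axis)

lemma gauss_times_differentiable: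
  "(\<lambda>x. t * gauss c x) differentiable (at x)"
  "(\<lambda>x. x $ i * gauss c x) differentiable (at x)"
  using gauss_differentiable[of c x]
  by (auto intro!: differentiable_mult bounded_linear_imp_differentiable[OF bounded_linear_vec_nth])

lemma partial_scaled_gauss: "partial i (\<lambda>x. t * gauss c x) = (\<lambda>x. - (t * c i * x $ i * gauss c x))"
  by (rule ext, subst partial_eqI[OF has_derivative_mult_right[OF gauss_has_derivative]])
    (simp add: sum_axis)

lemma partial_partial_gauss:
  "partial i (\<lambda>x. - (c i * x $ i * gauss c x)) = (\<lambda>x. ((c i)\<^sup>2 * (x $ i)\<^sup>2 - c i) * gauss c x)"
proof
  fix x :: "real^3"
  have D: "((\<lambda>x. - (c i * x $ i * gauss c x)) has_derivative
      (\<lambda>h. - (c i * x $ i * (gauss c x * - (\<Sum>i\<in>UNIV. c i * x $ i * h $ i)) + c i * h $ i * gauss c x))) (at x)"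
    by (intro has_derivative_minus has_derivative_mult has_derivative_mult_right gauss_has_derivative
        bounded_linear.has_derivative[OF bounded_linear_vec_nth] has_derivative_ident)
  show "partial i (\<lambda>x. - (c i * x $ i * gauss c x)) x = ((c i)\<^sup>2 * (x $ i)\<^sup>2 - c i) * gauss c x"
    unfolding partial_eqI[OF D] sum_axis
    by (simp add: axis_def power2_eq_square algebra_simps)
qed

lemma scaled_gauss_norm_L2:
  assumes "\<And>i. c i > 0"
  shows "has_bochner_integral lebesgue (\<lambda>x. (t * gauss c x)\<^sup>2) (t\<^sup>2 * gauss_integral (\<lambda>i. 2 * c i))"
  unfolding power_mult_distrib gauss_power2
  by (intro has_bochner_integral_mult_right has_integral_gauss) (simp add: assms)

lemma scaled_gauss_weak_gradient:
  fixes t :: real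
  assumes c: "\<And>i. c i > 0"
  defines "G \<equiv> (\<lambda>x. \<chi> i. - (t * c i * x $ i * gauss c x))"
  shows "square_integrable G" "has_weak_gradient (\<lambda>x. t * gauss c x) G"
    and "(\<integral>x. (norm (G x))\<^sup>2 \<partial>lebesgue) = t\<^sup>2 * gauss_integral (\<lambda>i. 2 * c i) * ((c 1 + c 2 + c 3) / 2)"
proof -
  let ?Z = "gauss_integral (\<lambda>i. 2 * c i)"
  have cont: "continuous_on UNIV (\<lambda>x. - (t * c i * x $ i * gauss c x))" for i
    by (intro continuous_intros gauss_continuous)
  \<comment> \<open>The derivative contributes c_i^2 and the second moment of the squared Gaussian 1
    / (2 c_i), hence c_i / 2.\<close>
  have *: "has_bochner_integral lebesgue (\<lambda>x. (G x $ i)\<^sup>2) (t\<^sup>2 * ?Z * (c i / 2))" for i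
  proof -
    have "has_bochner_integral lebesgue (\<lambda>x. (t * c i)\<^sup>2 * ((x $ i)\<^sup>2 * gauss (\<lambda>i. 2 * c i) x)) ((t * c i)\<^sup>2 * (?Z / (2 * c i)))"
      by (intro has_bochner_integral_mult_right has_integral_gauss) (simp add: c)
    moreover have "(t * c i)\<^sup>2 * (?Z / (2 * c i)) = t\<^sup>2 * ?Z * (c i / 2)"
      using c[of i] by (simp add: power2_eq_square)
    moreover have "(G x $ i)\<^sup>2 = (t * c i)\<^sup>2 * ((x $ i)\<^sup>2 * gauss (\<lambda>i. 2 * c i) x)" for x
      by (simp add: G_def power_mult_distrib gauss_power2)
    ultimately show ?thesis by (simp only:)
  qed
  have "has_bochner_integral lebesgue (\<lambda>x. (norm (G x))\<^sup>2) (t\<^sup>2 * ?Z * (c 1 / 2) + t\<^sup>2 * ?Z * (c 2 / 2) + t\<^sup>2 * ?Z * (c 3 / 2))"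
    unfolding norm_square_vec3 by (intro has_bochner_integral_add *)
  moreover have "G \<in> borel_measurable lebesgue"
    unfolding G_def by (intro borel_measurable_lebesgueI borel_measurable_continuous_onI continuous_on_vec_lambda cont)
  ultimately show "square_integrable G"
    "(\<integral>x. (norm (G x))\<^sup>2 \<partial>lebesgue) = t\<^sup>2 * ?Z * ((c 1 + c 2 + c 3) / 2)"
    by (auto simp: square_integrable_def has_bochner_integral_iff algebra_simps add_divide_distrib)
  show "has_weak_gradient (\<lambda>x. t * gauss c x) G"
    unfolding has_weak_gradient_def
  proof (intro allI impI)
    fix \<phi> i assume "test_function \<phi>"
    then show "(\<integral>x. t * gauss c x * partial i \<phi> x \<partial>lebesgue) = - (\<integral>x. G x $ i * \<phi> x \<partial>lebesgue)"
      using integral_by_parts_lebesgue[of "\<lambda>x. t * gauss c x" i \<phi>] gauss_times_differentiable(1) cont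
      by (simp add: partial_scaled_gauss G_def)
  qed
qed

lemma scaled_gauss_in_H:
  assumes c: "\<And>i. c i > 0"
  shows "(\<lambda>x. t * gauss c x) \<in> H"
    and "has_bochner_integral lebesgue (\<lambda>x. potential x * (t * gauss c x)\<^sup>2)
      (t\<^sup>2 * gauss_integral (\<lambda>i. 2 * c i) * (1 / (2 * c 1) + 1 / (2 * c 2)))"
proof -
  let ?Z = "gauss_integral (\<lambda>i. 2 * c i)" and ?g = "gauss (\<lambda>i. 2 * c i)"
  have "has_bochner_integral lebesgue (\<lambda>x. t\<^sup>2 * ((x $ 1)\<^sup>2 * ?g x) + t\<^sup>2 * ((x $ 2)\<^sup>2 * ?g x))
      (t\<^sup>2 * (?Z / (2 * c 1)) + t\<^sup>2 * (?Z / (2 * c 2)))"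
    by (intro has_bochner_integral_add has_bochner_integral_mult_right has_integral_gauss) (simp_all add: c)
  moreover have "t\<^sup>2 * ((x $ 1)\<^sup>2 * ?g x) + t\<^sup>2 * ((x $ 2)\<^sup>2 * ?g x) = potential x * (t * gauss c x)\<^sup>2" for x
    by (simp add: potential_def power_mult_distrib gauss_power2 algebra_simps)
  moreover have "t\<^sup>2 * (?Z / (2 * c 1)) + t\<^sup>2 * (?Z / (2 * c 2)) = t\<^sup>2 * ?Z * (1 / (2 * c 1) + 1 / (2 * c 2))"
    by (simp add: algebra_simps)
  ultimately show V: "has_bochner_integral lebesgue (\<lambda>x. potential x * (t * gauss c x)\<^sup>2)
      (t\<^sup>2 * ?Z * (1 / (2 * c 1) + 1 / (2 * c 2)))"
    by simp
  have "(\<lambda>x. t * gauss c x) \<in> borel_measurable lebesgue"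
    by (intro borel_measurable_lebesgueI) measurable
  then have "square_integrable (\<lambda>x. t * gauss c x)"
    using scaled_gauss_norm_L2[of c t, OF c] by (simp add: square_integrable_def has_bochner_integral_iff)
  then show "(\<lambda>x. t * gauss c x) \<in> H"
    using V scaled_gauss_weak_gradient(1,2)[of c t, OF c] by (auto simp: H_def H1_def has_bochner_integral_iff)
qed

text \<open>Uniqueness allows the classical gradient to replace the chosen one. In direction i the
  kinetic part is c_i / 2, and for i = 1, 2 the potential part is 1 / (2 c_i), all relative to the
  squared L2 norm.\<close>

lemma quad_form_scaled_gauss:
  assumes c: "\<And>i. c i > 0"
  shows "quad_form \<mu> (\<lambda>x. t * gauss c x) = t\<^sup>2 * gauss_integral (\<lambda>i. 2 * c i) *
    ((c 1 + c 2 + c 3) / 2 + 1 / (2 * c 1) + 1 / (2 * c 2) - \<mu>)"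
proof -
  let ?v = "\<lambda>x. t * gauss c x" and ?G = "\<lambda>x. \<chi> i. - (t * c i * x $ i * gauss c x)"
  note v = scaled_gauss_in_H[of c t, OF c]
  note W = scaled_gauss_weak_gradient[of c t, OF c]
  have "?v \<in> H1" using v(1) by (simp add: H_def)
  note G = square_integrable_weak_gradient[OF this]
  have "AE x in lebesgue. weak_gradient ?v x = ?G x"
    by (rule has_weak_gradient_unique[OF G W(1,2)])
  then have "(\<integral>x. (norm (weak_gradient ?v x))\<^sup>2 \<partial>lebesgue) = (\<integral>x. (norm (?G x))\<^sup>2 \<partial>lebesgue)"
    using G(1) W(1) by (intro integral_cong_AE) (auto simp: square_integrable_def elim!: eventually_mono)
  then show ?thesis
    unfolding quad_form_eq[OF v(1)] W(3) has_bochner_integral_integral_eq[OF v(2)]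
      has_bochner_integral_integral_eq[OF scaled_gauss_norm_L2[of c t, OF c]]
    by (simp add: algebra_simps add_divide_distrib)
qed

subsection \<open>A Weyl sequence\<close>

text \<open>Two integrations by parts per direction move the Laplacian onto the Gaussian, which then
  solves the operator equation in the distributional sense used by
  \<open>schroedinger\<close>.\<close>

lemma integral_laplacian_gauss:
  assumes \<phi>: "test_function \<phi>"
  shows "(\<integral>x. (- laplacian \<phi> x + potential x * \<phi> x) * gauss c x \<partial>lebesgue)
    = (\<integral>x. \<phi> x * ((- (\<Sum>i\<in>UNIV. (c i)\<^sup>2 * (x $ i)\<^sup>2 - c i) + potential x) * gauss c x) \<partial>lebesgue)"
proof -
  note \<phi>1 = test_function_partial[OF \<phi>]
  note \<phi>2 = test_function_partial[OF \<phi>1]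
  let ?g = "gauss c" and ?g1 = "\<lambda>i x. - (c i * x $ i * gauss c x)"
    and ?g2 = "\<lambda>i x. ((c i)\<^sup>2 * (x $ i)\<^sup>2 - c i) * gauss c x"
  have pc: "continuous_on UNIV potential"
    unfolding potential_def[abs_def] by (intro continuous_intros)
  have int: "integrable lebesgue (\<lambda>x. f x * \<psi> x)" if f: "continuous_on UNIV f" and \<psi>: "test_function \<psi>" for f \<psi>
  proof -
    obtain R where "\<And>x. x \<notin> cball 0 R \<Longrightarrow> \<psi> x = 0"
      using test_function_support[OF \<psi>] by blast
    then have "integrable lborel (\<lambda>x. f x * \<psi> x)"
      using f test_function_continuous[OF \<psi>]
      by (intro integrable_compact_support[of _ R] continuous_intros) auto
    then show ?thesis
      by (subst integrable_completion) (auto dest: borel_measurable_integrable)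
  qed
  have c1: "continuous_on UNIV (?g1 i)" and c2: "continuous_on UNIV (?g2 i)" for i
    by (intro continuous_intros gauss_continuous)+
  have parts: "(\<integral>x. ?g x * partial i (partial i \<phi>) x \<partial>lebesgue) = (\<integral>x. ?g2 i x * \<phi> x \<partial>lebesgue)" for i
  proof -
    have "(\<integral>x. ?g x * partial i (partial i \<phi>) x \<partial>lebesgue) = - (\<integral>x. ?g1 i x * partial i \<phi> x \<partial>lebesgue)"
      using integral_by_parts_lebesgue[OF gauss_differentiable, of i c "partial i \<phi>"] c1 \<phi>1
      by (simp add: partial_gauss)
    also have "(\<integral>x. ?g1 i x * partial i \<phi> x \<partial>lebesgue) = - (\<integral>x. ?g2 i x * \<phi> x \<partial>lebesgue)"
    proof -
      have "?g1 i differentiable (at x)" for x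
        using differentiable_minus[OF differentiable_cmult_left_iff[THEN iffD2, OF disjI2, OF gauss_times_differentiable(2)]]
        by (simp add: mult.assoc)
      then show ?thesis
        using integral_by_parts_lebesgue[of "?g1 i" i \<phi>] c2 \<phi>
        by (simp only: partial_partial_gauss)
    qed
    finally show ?thesis by simp
  qed
  have V: "integrable lebesgue (\<lambda>x. (potential x * ?g x) * \<phi> x)"
    by (intro int \<phi> continuous_intros pc gauss_continuous)
  have "(\<integral>x. (- laplacian \<phi> x + potential x * \<phi> x) * ?g x \<partial>lebesgue)
    = (\<integral>x. (potential x * ?g x) * \<phi> x - (\<Sum>i\<in>UNIV. ?g x * partial i (partial i \<phi>) x) \<partial>lebesgue)"
    by (intro Bochner_Integration.integral_cong) (simp_all add: laplacian_def sum_distrib_left algebra_simps)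
  also have "\<dots> = (\<integral>x. (potential x * ?g x) * \<phi> x \<partial>lebesgue) - (\<Sum>i\<in>UNIV. \<integral>x. ?g x * partial i (partial i \<phi>) x \<partial>lebesgue)"
    using V int[OF gauss_continuous \<phi>2] by (simp only: Bochner_Integration.integral_diff Bochner_Integration.integral_sum Bochner_Integration.integrable_sum)
  also have "\<dots> = (\<integral>x. (potential x * ?g x) * \<phi> x \<partial>lebesgue) - (\<Sum>i\<in>UNIV. \<integral>x. ?g2 i x * \<phi> x \<partial>lebesgue)"
    unfolding parts ..
  also have "\<dots> = (\<integral>x. (potential x * ?g x) * \<phi> x - (\<Sum>i\<in>UNIV. ?g2 i x * \<phi> x) \<partial>lebesgue)"
    using V int[OF c2 \<phi>] by (simp only: Bochner_Integration.integral_diff Bochner_Integration.integral_sum Bochner_Integration.integrable_sum)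
  also have "\<dots> = (\<integral>x. \<phi> x * ((- (\<Sum>i\<in>UNIV. (c i)\<^sup>2 * (x $ i)\<^sup>2 - c i) + potential x) * gauss c x) \<partial>lebesgue)"
    by (intro Bochner_Integration.integral_cong) (simp_all add: sum_distrib_left sum_distrib_right algebra_simps)
  finally show ?thesis .
qed

text \<open>Coefficients invariant under rotation about the x_3 axis: \<open>a\<close> in the two
  confined directions, \<open>b\<close> along the free one.\<close>

definition cyl_coeffs :: "real \<Rightarrow> real \<Rightarrow> 3 \<Rightarrow> real" where
  "cyl_coeffs a b i = (if i = 3 then b else a)"

lemma cyl_coeffs_simps [simp]: "cyl_coeffs a b 1 = a" "cyl_coeffs a b 2 = a" "cyl_coeffs a b 3 = b"
  by (simp_all add: cyl_coeffs_def)

lemma cyl_coeffs_pos: "a > 0 \<Longrightarrow> b > 0 \<Longrightarrow> cyl_coeffs a b i > 0"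
  by (simp add: cyl_coeffs_def)

lemma cyl_coeffs_mult: "(\<lambda>i. q * cyl_coeffs a b i) = cyl_coeffs (q * a) (q * b)"
  by (simp add: cyl_coeffs_def fun_eq_iff)

lemma prod_UNIV_3: "prod f (UNIV :: 3 set) = f 1 * f 2 * (f 3 :: real)"
  unfolding UNIV_3 by simp

lemma gauss_integral_cyl_coeffs:
  "gauss_integral (cyl_coeffs a b) = sqrt (2 * pi / a) * sqrt (2 * pi / a) * sqrt (2 * pi / b)"
  by (simp only: gauss_integral_def prod_UNIV_3 cyl_coeffs_simps)

text \<open>Trades the polynomial in the Weyl residual for a slightly wider Gaussian, so that no
  fourth moment has to be computed.\<close>

lemma square_one_minus_le_exp:
  fixes y :: real
  assumes "y \<ge> 0"
  shows "(1 - y)\<^sup>2 \<le> 8 * exp (y / 2)"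
proof -
  have "(1 - y)\<^sup>2 \<le> 8 * (1 + y / 2 + (y / 2)\<^sup>2 / 2)"
    using assms by (simp add: power2_eq_square field_simps)
  also have "\<dots> \<le> 8 * exp (y / 2)"
    using exp_lower_Taylor_quadratic[of "y / 2"] assms by simp
  finally show ?thesis .
qed

text \<open>Weyl sequence \<open>exp (- (x\<^sub>1\<^sup>2 + x\<^sub>2\<^sup>2 + b x\<^sub>3\<^sup>2) / 2)\<close>, \<open>b \<rightarrow> 0\<close>, at the point \<open>2\<close>.\<close>

lemma two_in_spectrum: "2 \<in> spectrum"
proof (rule ccontr)
  assume "2 \<notin> spectrum"
  then obtain C where C: "\<And>g u. square_integrable g \<Longrightarrow> schroedinger u (\<lambda>x. g x + 2 * u x) \<Longrightarrow>
      norm_L2 u \<le> C * norm_L2 g"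
    by (auto simp: spectrum_def resolvent_set_def)
  \<comment> \<open>The residual turns out to be at most 4 b times the norm of \<open>u\<close>;
    with this \<open>b\<close>, 4 b |C| < 1.\<close>
  define b where "b = 1 / (8 * (\<bar>C\<bar> + 1))"
  have b: "b > 0" by (simp add: b_def)
  define c where "c = cyl_coeffs 1 b"
  have c: "c i > 0" for i
    unfolding c_def using b by (intro cyl_coeffs_pos) auto
  \<comment> \<open>The residual of the operator minus 2 applied to \<open>gauss c\<close>: the
    coefficients 1 cancel the potential and the value 2, and only direction 3 is left.\<close>
  define f where "f x = (b - b\<^sup>2 * (x $ 3)\<^sup>2) * gauss c x" for x :: "real^3"
  define u :: "real^3 \<Rightarrow> complex" where "u x = of_real (gauss c x)" for x
  define g :: "real^3 \<Rightarrow> complex" where "g x = of_real (f x)" for x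
  let ?U = "gauss_integral (\<lambda>i. 2 * c i)"
  have [measurable]: "(\<lambda>x::real^3. x $ 3) \<in> borel_measurable borel"
    by (intro borel_measurable_continuous_onI continuous_intros)
  have fm: "f \<in> borel_measurable lebesgue"
    by (rule borel_measurable_lebesgueI) (simp add: f_def[abs_def])
  have gm: "gauss c \<in> borel_measurable lebesgue"
    by (rule borel_measurable_lebesgueI) simp
  have U: "has_bochner_integral lebesgue (\<lambda>x. (gauss c x)\<^sup>2) ?U"
    unfolding gauss_power2 by (intro has_integral_gauss) (simp add: c)
  have "?U > 0"
    by (intro gauss_integral_pos) (simp add: c)
  have u: "square_integrable u" "(norm_L2 u)\<^sup>2 = ?U"
    using U gm \<open>?U > 0\<close> by (auto simp: square_integrable_def norm_L2_def u_def[abs_def] has_bochner_integral_iff)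
  have f_le: "(f x)\<^sup>2 \<le> 8 * b\<^sup>2 * gauss (cyl_coeffs 2 b) x" for x
  proof -
    have "(f x)\<^sup>2 = b\<^sup>2 * ((1 - b * (x $ 3)\<^sup>2)\<^sup>2 * gauss (cyl_coeffs 2 (2 * b)) x)"
      unfolding f_def power_mult_distrib gauss_power2 by (simp add: c_def cyl_coeffs_mult power2_eq_square algebra_simps)
    also have "\<dots> \<le> b\<^sup>2 * (8 * exp (b * (x $ 3)\<^sup>2 / 2) * gauss (cyl_coeffs 2 (2 * b)) x)"
      using b by (intro mult_left_mono mult_right_mono square_one_minus_le_exp)
        (auto intro: less_imp_le[OF gauss_pos])
    also have "\<dots> = 8 * b\<^sup>2 * (exp (b * (x $ 3)\<^sup>2 / 2) * gauss (cyl_coeffs 2 (2 * b)) x)"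
      by (simp only: mult_ac)
    also have "exp (b * (x $ 3)\<^sup>2 / 2) * gauss (cyl_coeffs 2 (2 * b)) x = gauss (cyl_coeffs 2 b) x"
      by (simp add: gauss_def sum_3 exp_add[symmetric] algebra_simps add_divide_distrib[symmetric] diff_divide_distrib[symmetric])
    finally show ?thesis .
  qed
  have B: "has_bochner_integral lebesgue (\<lambda>x. 8 * b\<^sup>2 * gauss (cyl_coeffs 2 b) x) (8 * b\<^sup>2 * gauss_integral (cyl_coeffs 2 b))"
    by (intro has_bochner_integral_mult_right has_integral_gauss cyl_coeffs_pos) (use b in auto)
  have intf: "integrable lebesgue (\<lambda>x. (f x)\<^sup>2)"
  proof (rule Bochner_Integration.integrable_bound)
    show "integrable lebesgue (\<lambda>x. 8 * b\<^sup>2 * gauss (cyl_coeffs 2 b) x)"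
      using B by (rule integrable.intros)
    show "AE x in lebesgue. norm ((f x)\<^sup>2) \<le> norm (8 * b\<^sup>2 * gauss (cyl_coeffs 2 b) x)"
    proof (rule AE_I2)
      show "norm ((f x)\<^sup>2) \<le> norm (8 * b\<^sup>2 * gauss (cyl_coeffs 2 b) x)" for x
        using order_trans[OF f_le abs_ge_self] by simp
    qed
  qed (use fm in measurable)
  have g: "square_integrable g" "(norm_L2 g)\<^sup>2 = (\<integral>x. (f x)\<^sup>2 \<partial>lebesgue)"
    using intf fm by (auto simp: square_integrable_def norm_L2_def g_def[abs_def])
  have "(\<integral>x. (f x)\<^sup>2 \<partial>lebesgue) \<le> (\<integral>x. 8 * b\<^sup>2 * gauss (cyl_coeffs 2 b) x \<partial>lebesgue)"
    by (rule integral_mono[OF intf integrable.intros[OF B] f_le])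
  also have "\<dots> = 8 * b\<^sup>2 * gauss_integral (cyl_coeffs 2 b)"
    by (rule has_bochner_integral_integral_eq[OF B])
  \<comment> \<open>Widening the third coefficient from 2b to b multiplies the integral by sqrt 2,
    which is then rounded up to 2 to make 16 b^2 a square.\<close>
  also have "gauss_integral (cyl_coeffs 2 b) = sqrt 2 * ?U"
    using b by (simp add: c_def cyl_coeffs_mult gauss_integral_cyl_coeffs real_sqrt_divide real_sqrt_mult)
  also have "8 * b\<^sup>2 * (sqrt 2 * ?U) \<le> 8 * b\<^sup>2 * (2 * ?U)"
    using \<open>?U > 0\<close> by (intro mult_left_mono mult_right_mono) (auto simp: real_le_lsqrt sqrt2_less_2 less_imp_le)
  also have "\<dots> = (4 * b * norm_L2 u)\<^sup>2"
    by (simp add: power_mult_distrib u(2))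
  finally have "(norm_L2 g)\<^sup>2 \<le> (4 * b * norm_L2 u)\<^sup>2"
    by (simp add: g(2))
  moreover have nn: "norm_L2 u \<ge> 0" "norm_L2 g \<ge> 0"
    by (simp_all add: norm_L2_def)
  ultimately have gu: "norm_L2 g \<le> 4 * b * norm_L2 u"
    using b by (auto intro: power2_le_imp_le[of "norm_L2 g"])
  have "norm_L2 u > 0"
    using u(2) \<open>?U > 0\<close> nn(1) by (cases "norm_L2 u = 0") auto
  have "schroedinger u (\<lambda>x. g x + 2 * u x)"
    unfolding schroedinger_def
  proof (intro conjI allI impI u(1))
    have eq: "g x + 2 * u x = of_real (f x + 2 * gauss c x)" for x
      by (simp add: g_def u_def)
    have "integrable lebesgue (\<lambda>x. f x * gauss c x)"
      using fm gm intf U by (intro integrable_mult_square) (auto simp: has_bochner_integral_iff)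
    then have "integrable lebesgue (\<lambda>x. (f x)\<^sup>2 + 4 * (gauss c x)\<^sup>2 + 4 * (f x * gauss c x))"
      using intf integrable.intros[OF U] by simp
    then have "integrable lebesgue (\<lambda>x. (f x + 2 * gauss c x)\<^sup>2)"
      by (simp add: power2_sum power_mult_distrib mult_ac)
    moreover have "(\<lambda>x. f x + 2 * gauss c x) \<in> borel_measurable lebesgue"
      using fm gm by (auto intro!: borel_measurable_add)
    then have "(\<lambda>x. complex_of_real (f x + 2 * gauss c x)) \<in> borel_measurable lebesgue"
      by (rule measurable_compose[OF _ borel_measurable_of_real])
    ultimately show "square_integrable (\<lambda>x. g x + 2 * u x)"
      unfolding square_integrable_def eq norm_of_real power2_abs by (intro conjI)
    fix \<phi> assume \<phi>: "test_function \<phi>"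
    have lhs: "(- laplacian \<phi> x + potential x * \<phi> x) *\<^sub>R u x
        = complex_of_real ((- laplacian \<phi> x + potential x * \<phi> x) * gauss c x)" for x
      by (simp add: u_def scaleR_conv_of_real)
    have "(- (\<Sum>i\<in>UNIV. (c i)\<^sup>2 * (x $ i)\<^sup>2 - c i) + potential x) * gauss c x = f x + 2 * gauss c x" for x
      by (simp add: sum_3 potential_def f_def c_def algebra_simps)
    then have rhs: "\<phi> x *\<^sub>R (g x + 2 * u x)
        = complex_of_real (\<phi> x * ((- (\<Sum>i\<in>UNIV. (c i)\<^sup>2 * (x $ i)\<^sup>2 - c i) + potential x) * gauss c x))" for x
      unfolding eq by (simp add: scaleR_conv_of_real)
    show "(\<integral>x. (- laplacian \<phi> x + potential x * \<phi> x) *\<^sub>R u x \<partial>lebesgue)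
        = (\<integral>x. \<phi> x *\<^sub>R (g x + 2 * u x) \<partial>lebesgue)"
      unfolding lhs rhs integral_complex_of_real integral_laplacian_gauss[OF \<phi>] ..
  qed
  from C[OF g(1) this] have "norm_L2 u \<le> C * norm_L2 g" .
  also have "\<dots> \<le> \<bar>C\<bar> * norm_L2 g"
    using nn by (intro mult_right_mono) auto
  also have "\<dots> \<le> \<bar>C\<bar> * (4 * b * norm_L2 u)"
    using gu by (intro mult_left_mono) auto
  also have "\<dots> = (4 * b * \<bar>C\<bar>) * norm_L2 u" by simp
  finally have "1 \<le> 4 * b * \<bar>C\<bar>"
    using \<open>norm_L2 u > 0\<close> by simp
  moreover have "4 * b * \<bar>C\<bar> < 1"
    by (simp add: b_def field_simps)
  ultimately show False by simp
qed

text \<open>Ensures that 2 - mu is positive for every admissible mu, so that the lower bound on the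
  quadratic form can be divided by it.\<close>

lemma Lambda0_le_2: "\<Lambda>\<^sub>0 \<le> 2"
proof -
  have "\<Lambda>\<^sub>0 \<le> ereal 2"
    unfolding \<Lambda>\<^sub>0_def by (rule INF_lower) (use two_in_spectrum in simp)
  then show ?thesis by simp
qed

subsection \<open>Ground states\<close>

text \<open>The test function \<open>t\<close> times a Gaussian, with \<open>t\<close> chosen such that it lies on the Nehari
  manifold. On the latter \<open>J\<close> is a positive multiple of the quadratic form.\<close>

lemma ground_state_norm_bound_gauss:
  assumes p: "2 < p" and gs: "ground_state p \<mu> u" and a: "a > 0" and b: "b > 0"
    and \<kappa>: "\<kappa> = a + 1 / a + b / 2 - \<mu>" "\<kappa> > 0"
  shows "(2 - \<mu>) * (norm_L2 u)\<^sup>2 \<le>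
    (\<kappa> / sqrt (2 / p) ^ 3) powr (2 / (p - 2)) * \<kappa> * (sqrt pi ^ 3 / (a * sqrt b))"
proof -
  define c where "c = cyl_coeffs a b"
  have c: "c i > 0" for i
    unfolding c_def using a b by (rule cyl_coeffs_pos)
  \<comment> \<open>The ratio of the integrals of the p-th and the second power of the Gaussian; it
    is the same for all coefficients.\<close>
  define s where "s = sqrt (2 / p) ^ 3"
  have s: "s > 0" using p by (simp add: s_def)
  define Z where "Z = gauss_integral (\<lambda>i. 2 * c i)"
  have Z_eq: "Z = sqrt pi ^ 3 / (a * sqrt b)"
    using a b by (simp add: Z_def c_def cyl_coeffs_mult gauss_integral_cyl_coeffs real_sqrt_divide power3_eq_cube)
  have Zp: "gauss_integral (\<lambda>i. p * c i) = s * Z"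
  proof -
    have "sqrt (2 * pi / (p * c i)) = sqrt (2 / p) * sqrt (2 * pi / (2 * c i))" for i
      by (simp flip: real_sqrt_mult)
    then show ?thesis
      unfolding gauss_integral_def Z_def s_def by (simp add: prod.distrib)
  qed
  \<comment> \<open>The positive solution of t^p s Z = t^2 Z kappa, the Nehari condition for t times
    the Gaussian.\<close>
  define t where "t = (\<kappa> / s) powr (1 / (p - 2))"
  have t: "t > 0" using \<kappa>(2) s by (simp add: t_def)
  have tp: "t powr p = t\<^sup>2 * (\<kappa> / s)"
  proof -
    have "t powr (p - 2) = \<kappa> / s"
      using p \<kappa>(2) s by (simp add: t_def powr_powr)
    then have "t powr p = t powr 2 * (\<kappa> / s)"
      by (metis add.commute diff_add_cancel powr_add)
    then show ?thesis using t by simp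
  qed
  define v where "v x = t * gauss c x" for x
  have vH: "v \<in> H"
    unfolding v_def[abs_def] by (rule scaled_gauss_in_H[OF c])
  have Q: "quad_form \<mu> v = t\<^sup>2 * Z * \<kappa>"
    using a b unfolding v_def[abs_def] quad_form_scaled_gauss[OF c] Z_def \<kappa>(1)
    by (simp add: c_def add_divide_distrib)
  have powr_v: "\<bar>v x\<bar> powr p = t powr p * gauss (\<lambda>i. p * c i) x" for x
    using t by (simp add: v_def powr_mult abs_mult gauss_powr less_imp_le[OF gauss_pos])
  have "(\<integral>x. \<bar>v x\<bar> powr p \<partial>lebesgue) = t powr p * (s * Z)"
    unfolding powr_v Zp[symmetric]
    by (rule has_bochner_integral_integral_eq, intro has_bochner_integral_mult_right has_integral_gauss)
      (use c p in simp)
  also have "\<dots> = t\<^sup>2 * Z * \<kappa>"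
    using s by (simp add: tp)
  finally have P: "(\<integral>x. \<bar>v x\<bar> powr p \<partial>lebesgue) = quad_form \<mu> v"
    by (simp add: Q)
  have "\<not> (AE x in lebesgue. v x = 0)"
  proof
    assume "AE x in lebesgue. v x = 0"
    moreover have "v x \<noteq> 0" for x
      using t gauss_pos[of c x] by (simp add: v_def)
    ultimately have "AE x in (lebesgue :: (real^3) measure). False"
      by simp
    then show False
      by (simp add: ae_filter_eq_bot_iff eventually_False)
  qed
  with vH P have v: "v \<in> nehari p \<mu>"
    by (simp add: nehari_def)
  have J: "J p \<mu> w = (1 / 2 - 1 / p) * quad_form \<mu> w" "0 \<le> quad_form \<mu> w" if "w \<in> nehari p \<mu>" for w
  proof -
    from that have "quad_form \<mu> w = (\<integral>x. \<bar>w x\<bar> powr p \<partial>lebesgue)"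
      by (simp add: nehari_def)
    then show "J p \<mu> w = (1 / 2 - 1 / p) * quad_form \<mu> w" "0 \<le> quad_form \<mu> w"
      by (simp_all add: J_def algebra_simps)
  qed
  have p': "1 / 2 - 1 / p > 0" using p by (simp add: field_simps)
  have u: "u \<in> nehari p \<mu>" and "J p \<mu> u = (INF v\<in>nehari p \<mu>. J p \<mu> v)"
    using gs by (auto simp: ground_state_def)
  \<comment> \<open>A real-valued infimum is a lower bound only for sets bounded below. Here 0 is
    such a bound, because on the manifold the quadratic form equals the integral of a p-th
    power.\<close>
  moreover have "(INF v\<in>nehari p \<mu>. J p \<mu> v) \<le> J p \<mu> v"
  proof (rule cINF_lower[OF _ v])
    show "bdd_below (J p \<mu> ` nehari p \<mu>)"
      using J p' by (intro bdd_belowI2[of _ 0]) auto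
  qed
  ultimately have "(1 / 2 - 1 / p) * quad_form \<mu> u \<le> (1 / 2 - 1 / p) * quad_form \<mu> v"
    using J(1)[OF u] J(1)[OF v] by linarith
  then have "quad_form \<mu> u \<le> quad_form \<mu> v"
    by (rule mult_left_le_imp_le[OF _ p'])
  moreover have "(2 - \<mu>) * (norm_L2 u)\<^sup>2 \<le> quad_form \<mu> u"
    by (rule quad_form_lower_bound) (use u in \<open>simp add: nehari_def\<close>)
  ultimately have "(2 - \<mu>) * (norm_L2 u)\<^sup>2 \<le> t\<^sup>2 * \<kappa> * Z"
    by (simp add: Q mult_ac)
  also have "t\<^sup>2 = (\<kappa> / s) powr (2 / (p - 2))"
    using \<kappa>(2) s by (simp add: t_def powr_power)
  finally show ?thesis
    unfolding s_def Z_eq .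
qed

lemma ground_state_norm_bound:
  assumes p: "10 / 3 < p" "p < 6" and gs: "ground_state p \<mu> u" and \<mu>: "\<mu> < 2"
  shows "(norm_L2 u)\<^sup>2 \<le> (5 / 2 / sqrt (2 / p) ^ 3) powr (2 / (p - 2)) * (5 / 2) * sqrt pi ^ 3"
proof -
  define \<delta> where "\<delta> = 2 - \<mu>"
  have \<delta>: "\<delta> > 0" using \<mu> by (simp add: \<delta>_def)
  have \<mu>_eq: "\<mu> = 2 - \<delta>" by (simp add: \<delta>_def)
  define q where "q = 2 / (p - 2)"
  have q: "1 / 2 \<le> q" "q \<le> 3 / 2" "q > 0"
    using p by (auto simp: q_def field_simps)
  define s where "s = sqrt (2 / p) ^ 3"
  have s: "s > 0" using p by (simp add: s_def)
  \<comment> \<open>the profile for \<open>\<mu> \<rightarrow> 2\<close> is spread out in the direction \<open>x\<^sub>3\<close> only; for \<open>\<mu> \<rightarrow> -\<infinity>\<close> it concentrates at a point\<close>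
  define a where "a = max 1 \<delta>"
  have a: "a > 0" "a \<ge> 1" by (auto simp: a_def)
  define \<kappa> where "\<kappa> = a + 1 / a + \<delta> / 2 - \<mu>"
  have "(a - 1)\<^sup>2 \<ge> 0" by simp
  then have "2 \<le> a + 1 / a"
    using a by (simp add: power2_eq_square field_simps)
  then have "\<kappa> > 0" using \<delta> \<mu> by (simp add: \<kappa>_def)
  \<comment> \<open>For delta <= 1 one has a + 1/a = 2 and kappa = 3/2 delta exactly. For delta > 1,
    kappa = 5/2 delta + 1/delta - 2, and 1/delta <= 1. So 5/2 serves in both regimes.\<close>
  have \<kappa>_le: "\<kappa> \<le> 5 / 2 * \<delta>"
  proof (cases "\<delta> \<le> 1")
    case True
    then have "a = 1" by (simp add: a_def)
    then show ?thesis using \<delta> unfolding \<kappa>_def \<mu>_eq by simp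
  next
    case False
    then have "a = \<delta>" "1 / a \<le> 1" using a by (simp_all add: a_def)
    then show ?thesis unfolding \<kappa>_def \<mu>_eq by linarith
  qed
  \<comment> \<open>The denominator is delta^(1/2) for delta <= 1 and delta^(3/2) for delta > 1; the
    bounds 1/2 <= q and q <= 3/2 match these two exponents.\<close>
  have scale: "\<delta> powr q / (a * sqrt \<delta>) \<le> 1"
  proof (cases "\<delta> \<le> 1")
    case True
    have "\<delta> powr q \<le> \<delta> powr (1 / 2)"
      using True \<delta> q by (intro powr_mono') auto
    then show ?thesis using True \<delta> by (simp add: a_def powr_half_sqrt)
  next
    case False
    have "\<delta> powr q \<le> \<delta> powr (1 + 1 / 2)"
      using False q by (intro powr_mono) auto
    also have "\<dots> = \<delta> * sqrt \<delta>"
      unfolding powr_add using \<delta> by (simp add: powr_half_sqrt)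
    finally show ?thesis using False \<delta> by (simp add: a_def)
  qed
  have "\<delta> * (norm_L2 u)\<^sup>2 \<le> (\<kappa> / s) powr q * \<kappa> * (sqrt pi ^ 3 / (a * sqrt \<delta>))"
    using ground_state_norm_bound_gauss[OF _ gs a(1) \<delta> \<kappa>_def \<open>\<kappa> > 0\<close>] p
    by (simp add: \<delta>_def s_def q_def)
  also have "\<dots> \<le> ((5 / 2 * \<delta>) / s) powr q * (5 / 2 * \<delta>) * (sqrt pi ^ 3 / (a * sqrt \<delta>))"
    using \<kappa>_le \<open>\<kappa> > 0\<close> \<delta> a s q
    by (intro mult_right_mono mult_mono powr_mono2 divide_right_mono) auto
  \<comment> \<open>One factor delta, coming from \<open>\<kappa>\<close>, is split off to cancel
    the delta on the left; what remains is the quantity bounded in \<open>scale\<close>.\<close>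
  also have "\<dots> = \<delta> * ((5 / 2 / s) powr q * (5 / 2) * sqrt pi ^ 3 * (\<delta> powr q / (a * sqrt \<delta>)))"
  proof -
    have "((5 / 2 * \<delta>) / s) powr q = (5 / 2 / s) powr q * \<delta> powr q"
      using s \<delta> by (subst powr_mult[symmetric]) auto
    then show ?thesis by simp
  qed
  finally have "(norm_L2 u)\<^sup>2 \<le> (5 / 2 / s) powr q * (5 / 2) * sqrt pi ^ 3 * (\<delta> powr q / (a * sqrt \<delta>))"
    using \<delta> by (simp only: mult_le_cancel_left_pos)
  also have "\<dots> \<le> (5 / 2 / s) powr q * (5 / 2) * sqrt pi ^ 3 * 1"
    using s by (intro mult_left_mono scale) auto
  finally show ?thesis
    by (simp add: s_def q_def)
qed

text \<open>The supremum is formed in \<open>ereal\<close>, so that it presupposes no boundedness.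
  The last conjunct is the nonexistence of ground states with large norm, with the same constant and
  for ground states of any sign.\<close>

theorem theorem1p8:
  fixes p :: real
  assumes "10 / 3 < p" and "p < 6"
  shows "\<exists>C>0.
    (\<forall>u :: real \<Rightarrow> real^3 \<Rightarrow> real.
       (\<forall>\<mu>. ereal \<mu> < \<Lambda>\<^sub>0 \<longrightarrow> positive_ground_state p \<mu> (u \<mu>)) \<longrightarrow>
       (SUP \<mu>\<in>{\<mu>. ereal \<mu> < \<Lambda>\<^sub>0}. ereal (norm_L2 (u \<mu>))) \<le> ereal C) \<and>
    (\<forall>\<mu> v. ereal \<mu> < \<Lambda>\<^sub>0 \<longrightarrow> ground_state p \<mu> v \<longrightarrow> norm_L2 v \<le> C)"
proof -
  define C where "C = sqrt ((5 / 2 / sqrt (2 / p) ^ 3) powr (2 / (p - 2)) * (5 / 2) * sqrt pi ^ 3)"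
  have "C > 0" using assms by (simp add: C_def)
  have bound: "norm_L2 v \<le> C" if "ereal \<mu> < \<Lambda>\<^sub>0" "ground_state p \<mu> v" for \<mu> v
  proof -
    have "ereal \<mu> < ereal 2"
      using that(1) Lambda0_le_2 by (metis less_le_trans numeral_eq_ereal)
    then have "\<mu> < 2" by simp
    from ground_state_norm_bound[OF assms that(2) this] show ?thesis
      unfolding C_def by (rule real_le_rsqrt)
  qed
  show ?thesis
    using \<open>C > 0\<close> bound
    by (intro exI[of _ C]) (auto intro!: SUP_least simp: positive_ground_state_def)
qed

end
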